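(* Let $f\in\mathbb{A}^2(\mathbf{D})$, let $n$ be a positive integer, and let $a_1,\dots,a_{n-1}\in\mathbf{D}$ (repetitions allowed). For $b\in\mathbf{D}$ let $(B_1,\dots,B_{n-1},B_n^b)$ be the Gram–Schmidt orthonormalization of the generalized reproducing kernels $(\tilde k_{a_1},\dots,\tilde k_{a_{n-1}},\tilde k_b)$ associated with the $n$-tuple $(a_1,\dots,a_{n-1},b)$. Then there exists $a_n\in\mathbf{D}$ such that $$|\langle f,B_n^{a_n}\rangle|^2=\sup\{|\langle f,B_n^b\rangle|^2:\ b\in\mathbf{D}\}.$$
   Context: $\mathbf{D}$ is the open unit disc. $\mathbb{A}^2(\mathbf{D})$ is the Hilbert space of holomorphic functions $f$ on $\mathbf{D}$ with $\|f\|^2=\int_{\mathbf{D}}|f|^2\,dA<\infty$, $dA=dx\,dy/\pi$, with inner product $\langle f,g\rangle=\int_{\mathbf{D}}f\overline g\,dA$. Its reproducing kernel is $k_w(z)=\frac{1}{(1-\overline w z)^2}$. For a tuple $(a_1,\dots,a_n)$ of points of $\mathbf{D}$ (repetitions allowed), $l(a_j)$ is the number of times the value $a_j$ occurs in $(a_1,\dots,a_j)$, and the generalized reproducing kernels associated with the tuple are $\tilde k_{a_j}(z)=\left(\frac{d}{d\overline w}\right)^{l(a_j)-1}k_w(z)\big|_{w=a_j}$, $j=1,\dots,n$; in particular $\tilde k_b$ above depends on how many times $b$ occurs in $(a_1,\dots,a_{n-1},b)$. *)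

theory Defs
  imports "HOL-Complex_Analysis.Complex_Analysis"
begin

abbreviation unit_disc :: "complex set" ("\<bbbD>")
  where "\<bbbD> \<equiv> ball 0 1"

text \<open>
  Functions on the disc are represented by total functions on the complex plane; every notion
  below depends on their values inside the disc only.
\<close>

definition bergman_space :: "(complex \<Rightarrow> complex) set" where
  "bergman_space =
     {f. f holomorphic_on \<bbbD> \<and> set_integrable lborel \<bbbD> (\<lambda>z. (cmod (f z))\<^sup>2)}"

text \<open>The factor \<open>1 / pi\<close> comes from the normalised area measure \<open>dA = dx dy / pi\<close>.\<close>

definition bergman_inner :: "(complex \<Rightarrow> complex) \<Rightarrow> (complex \<Rightarrow> complex) \<Rightarrow> complex" where
  "bergman_inner f g = (LINT z:\<bbbD>|lborel. f z * cnj (g z)) / of_real pi"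

definition bergman_norm :: "(complex \<Rightarrow> complex) \<Rightarrow> real" where
  "bergman_norm f = sqrt ((LINT z:\<bbbD>|lborel. (cmod (f z))\<^sup>2) / pi)"

definition bergman_kernel :: "complex \<Rightarrow> complex \<Rightarrow> complex" where
  "bergman_kernel w z = 1 / (1 - cnj w * z)\<^sup>2"

text \<open>
  The Wirtinger derivative with respect to the conjugate variable: for \<open>w = x + \<i> y\<close> it is
  \<open>(1/2) (d/dx + \<i> d/dy)\<close>, expressed through the real Frechet derivative.
\<close>

definition wirtinger_cnj :: "(complex \<Rightarrow> complex) \<Rightarrow> complex \<Rightarrow> complex" where
  "wirtinger_cnj g w =
     (frechet_derivative g (at w) 1 + \<i> * frechet_derivative g (at w) \<i>) / 2"

text \<open>
  Tuples are lists, indexed from 0: \<open>occurrence as j\<close> counts how often the value \<open>as ! j\<close>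
  occurs among the entries \<open>as ! 0, \<dots>, as ! j\<close>.
\<close>

definition occurrence :: "complex list \<Rightarrow> nat \<Rightarrow> nat" where
  "occurrence as j = count_list (take (Suc j) as) (as ! j)"

definition gen_kernel :: "complex list \<Rightarrow> nat \<Rightarrow> complex \<Rightarrow> complex" where
  "gen_kernel as j z =
     (wirtinger_cnj ^^ (occurrence as j - 1)) (\<lambda>w. bergman_kernel w z) (as ! j)"

definition gen_kernels :: "complex list \<Rightarrow> (complex \<Rightarrow> complex) list" where
  "gen_kernels as = map (gen_kernel as) [0..<length as]"

definition bergman_normalize :: "(complex \<Rightarrow> complex) \<Rightarrow> complex \<Rightarrow> complex" where
  "bergman_normalize u z = u z / of_real (bergman_norm u)"

definition gram_schmidt_step ::
  "(complex \<Rightarrow> complex) list \<Rightarrow> (complex \<Rightarrow> complex) \<Rightarrow> (complex \<Rightarrow> complex) list" where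
  "gram_schmidt_step Bs v =
     Bs @ [bergman_normalize (\<lambda>z. v z - (\<Sum>B\<leftarrow>Bs. bergman_inner v B * B z))]"

definition gram_schmidt_orthonormalization ::
  "(complex \<Rightarrow> complex) list \<Rightarrow> (complex \<Rightarrow> complex) list" where
  "gram_schmidt_orthonormalization vs = foldl gram_schmidt_step [] vs"

end

theory Submission
  imports Defs
begin

text \<open>
  Write \<open>P(z) = (z - a\<^sub>1) \<dots> (z - a\<^sub>n\<^sub>-\<^sub>1)\<close>. By the reproducing property, the orthogonal complement of
  \<open>B\<^sub>1, \<dots>, B\<^sub>n\<^sub>-\<^sub>1\<close> consists of the functions \<open>P k\<close> in the Bergman space with \<open>k\<close> holomorphic.
  Let \<open>u\<^sub>b\<close> be the unnormalized last Gram-Schmidt vector, and let \<open>m\<close> be the multiplicity of \<open>b\<close>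
  among \<open>a\<^sub>1, \<dots>, a\<^sub>n\<^sub>-\<^sub>1\<close>. Pairing \<open>P k\<close> with \<open>u\<^sub>b\<close> gives the \<open>m\<close>-th derivative of \<open>P k\<close> at \<open>b\<close>,
  which is \<open>c(b) k(b)\<close> for a number \<open>c(b) \<noteq> 0\<close> independent of \<open>k\<close>. If \<open>P h\<close> is the projection of \<open>f\<close>,
  the squared coefficient \<open>F(b)\<close> is therefore the minimum of \<open>\<bar>h(b)\<bar>\<^sup>2 \<parallel>P k\<parallel>\<^sup>2 / \<bar>k(b)\<bar>\<^sup>2\<close> over \<open>k\<close> with
  \<open>k(b) \<noteq> 0\<close>, by Cauchy-Schwarz with equality for \<open>P k = u\<^sub>b\<close>. This description does not see whether
  \<open>b\<close> is one of the \<open>a\<^sub>j\<close>, and it exhibits \<open>F\<close> as an infimum of functions continuous where they are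
  defined, so \<open>F\<close> is upper semicontinuous on the disc. Taking for \<open>k\<close> the Bergman kernel at \<open>b\<close> gives
  \<open>F(b) \<le> 4\<^sup>n\<^sup>-\<^sup>1 \<bar>h(b)\<bar>\<^sup>2 (1 - \<bar>b\<bar>\<^sup>2)\<^sup>2\<close>, which tends to 0 at the boundary because
  \<open>P h\<close> is square integrable and \<open>P\<close> is bounded below there. Hence \<open>F\<close> attains its maximum.
\<close>

section \<open>Moments of area measure on discs\<close>

no_notation fps_nth (infixl "$" 75)

section \<open>Rotation invariance of area measure on the complex plane\<close>

text \<open>Measures with the right values on boxes coincide, and the coordinate map carries boxes
  to boxes with the same sides. This moves orthogonal invariance from \<open>real^2\<close> to the
  complex plane.\<close>

lemma lborel_complex_eq_distr:
  "(lborel :: complex measure) = distr (lborel :: (real^2) measure) borel (\<lambda>x. Complex (x$1) (x$2))"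
proof (rule lborel_eqI)
  have cont: "continuous_on UNIV (\<lambda>x::real^2. Complex (x$1) (x$2))"
    by (simp add: Complex_eq) (intro continuous_intros)
  then have [measurable]: "(\<lambda>x::real^2. Complex (x$1) (x$2)) \<in> borel_measurable borel"
    by (rule borel_measurable_continuous_onI)
  fix l u :: complex
  assume le: "\<And>b. b \<in> Basis \<Longrightarrow> l \<bullet> b \<le> u \<bullet> b"
  have le': "Re l \<le> Re u" "Im l \<le> Im u"
    using le[of 1] le[of \<i>] by (auto simp: Basis_complex_def)
  have vimage: "(\<lambda>x::real^2. Complex (x$1) (x$2)) -` box l u
      = box (vector [Re l, Im l]) (vector [Re u, Im u])"
    by (auto simp: mem_box Basis_complex_def Basis_vec_def inner_axis forall_2 vector_2)
  have "emeasure lborel (box (vector [Re l, Im l]) (vector [Re u, Im u] :: real^2))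
      = (\<Prod>b\<in>Basis. ((vector [Re u, Im u] :: real^2) - vector [Re l, Im l]) \<bullet> b)"
  proof (rule emeasure_lborel_box)
    fix b :: "real^2" assume "b \<in> Basis"
    then show "(vector [Re l, Im l] :: real^2) \<bullet> b \<le> vector [Re u, Im u] \<bullet> b"
      using le' forall_2[of "\<lambda>i. (vector [Re l, Im l] :: real^2) $ i \<le> vector [Re u, Im u] $ i"]
      by (auto simp: Basis_vec_def inner_axis vector_2)
  qed
  also have "(\<Prod>b\<in>Basis. ((vector [Re u, Im u] :: real^2) - vector [Re l, Im l]) \<bullet> b)
      = (\<Prod>i\<in>(UNIV::2 set). ((vector [Re u, Im u] :: real^2) - vector [Re l, Im l]) $ i)"
  proof -
    have B: "(Basis :: (real^2) set) = (\<lambda>i. axis i 1) ` UNIV"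
      by (auto simp: Basis_vec_def)
    have inj: "inj (\<lambda>i::2. axis i (1::real))"
      by (auto simp: inj_on_def axis_eq_axis)
    show ?thesis
      unfolding B prod.reindex[OF inj] by (simp add: inner_axis)
  qed
  also have "\<dots> = (\<Prod>b\<in>Basis. (u - l) \<bullet> b)"
    by (simp add: UNIV_2 vector_2 Basis_complex_def)
  finally show "emeasure (distr (lborel :: (real^2) measure) borel (\<lambda>x. Complex (x$1) (x$2))) (box l u)
      = ennreal (\<Prod>b\<in>Basis. (u - l) \<bullet> b)"
    by (simp add: emeasure_distr vimage)
qed simp

text \<open>It suffices to measure preimages of boxes. Such a preimage is the image of the box under
  \<open>inv R\<close>, which is again orthogonal and so preserves volume.\<close>

lemma lborel_distr_orthogonal:
  fixes R :: "real^'n::{finite,wellorder} \<Rightarrow> real^'n::_"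
  assumes "orthogonal_transformation R"
  shows "distr lborel borel R = lborel"
proof (rule lborel_eqI[symmetric])
  fix l u :: "real^'n::_"
  assume le: "\<And>b. b \<in> Basis \<Longrightarrow> l \<bullet> b \<le> u \<bullet> b"
  have "bij R" using assms by (rule orthogonal_transformation_bij)
  have orth': "orthogonal_transformation (inv R)"
    using assms by (rule orthogonal_transformation_inv)
  have [measurable]: "R \<in> borel_measurable borel"
    using orthogonal_transformation_linear[OF assms]
    by (intro borel_measurable_continuous_onI linear_continuous_on)
      (simp add: linear_conv_bounded_linear)
  have vimage: "R -` box l u = inv R ` box l u"
    using \<open>bij R\<close> by (simp add: bij_vimage_eq_inv_image)
  have meas: "inv R ` box l u \<in> lmeasurable"
    by (intro measurable_orthogonal_image orth' lmeasurable_box)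
  have "inv R ` box l u \<in> sets borel"
    unfolding vimage[symmetric] by (rule measurable_sets_borel[where M = borel]) simp_all
  \<comment> \<open>The volume formulas for orthogonal images concern \<open>lebesgue\<close>; the
    two measures agree on this set because it is Borel.\<close>
  then have "emeasure lborel (inv R ` box l u) = emeasure lebesgue (inv R ` box l u)"
    by simp
  also have "\<dots> = ennreal (measure lebesgue (inv R ` box l u))"
    by (rule emeasure_eq_ennreal_measure) (use fmeasurableD2[OF meas] in simp)
  also have "\<dots> = ennreal (measure lebesgue (box l u))"
    by (simp add: measure_orthogonal_image[OF orth'])
  also have "\<dots> = ennreal (\<Prod>b\<in>Basis. (u - l) \<bullet> b)"
    using le by (simp add: inner_diff_left)
  finally show "emeasure (distr lborel borel R) (box l u) = ennreal (\<Prod>b\<in>Basis. (u - l) \<bullet> b)"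
    by (simp add: emeasure_distr vimage)
qed simp

text \<open>In coordinates, multiplication by \<open>w\<close> is the rotation matrix
  \<open>R\<close>. The identity \<open>w * T x = T (R x)\<close> carries invariance under
  \<open>R\<close> over to the plane.\<close>

lemma lborel_distr_rotation:
  fixes w :: complex
  assumes "cmod w = 1"
  shows "distr lborel borel ((*) w) = lborel"
proof -
  define T :: "real^2 \<Rightarrow> complex" where "T = (\<lambda>x. Complex (x$1) (x$2))"
  define R :: "real^2 \<Rightarrow> real^2"
    where "R = (\<lambda>x. vector [Re w * x$1 - Im w * x$2, Im w * x$1 + Re w * x$2])"
  have "continuous_on UNIV T"
    unfolding T_def by (simp add: Complex_eq) (intro continuous_intros)
  then have [measurable]: "T \<in> borel_measurable borel"
    by (rule borel_measurable_continuous_onI)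
  have w2: "Re w * Re w + Im w * Im w = 1"
    using assms by (metis cmod_power2 power2_eq_square power_one)
  have "linear R"
    by (rule linearI) (simp_all add: R_def vec_eq_iff forall_2 vector_2 algebra_simps)
  moreover have "norm (R x) = norm x" for x
  proof -
    have "(Re w * x$1 - Im w * x$2)\<^sup>2 + (Im w * x$1 + Re w * x$2)\<^sup>2
        = (Re w * Re w + Im w * Im w) * ((x$1)\<^sup>2 + (x$2)\<^sup>2)"
      by algebra
    then show ?thesis
      unfolding norm_eq_sqrt_inner R_def w2
      by (simp add: inner_vec_def sum_2 vector_2 power2_eq_square)
  qed
  ultimately have orth: "orthogonal_transformation R"
    by (simp add: orthogonal_transformation)
  then have [measurable]: "R \<in> borel_measurable borel"
    using orthogonal_transformation_linear[OF orth]
    by (intro borel_measurable_continuous_onI linear_continuous_on)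
      (simp add: linear_conv_bounded_linear)
  have [measurable]: "(*) w \<in> borel_measurable borel"
    by (intro borel_measurable_continuous_onI continuous_intros)
  have eq: "(*) w \<circ> T = T \<circ> R"
    by (auto simp: T_def R_def vector_2 complex_eq_iff)
  have lb: "(lborel :: complex measure) = distr lborel borel T"
    unfolding T_def by (rule lborel_complex_eq_distr)
  have "distr lborel borel ((*) w) = distr (distr lborel borel T) borel ((*) w)"
    by (simp add: lb[symmetric])
  also have "\<dots> = distr lborel borel (T \<circ> R)"
    by (simp add: distr_distr eq)
  also have "\<dots> = distr (distr lborel borel R) borel T"
    by (simp add: distr_distr)
  also have "\<dots> = lborel"
    by (simp add: lborel_distr_orthogonal[OF orth] lb[symmetric])
  finally show ?thesis .
qed

section \<open>Integrals of monomials\<close>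

lemma set_integrable_ball_bounded:
  fixes f :: "complex \<Rightarrow> 'b::{banach, second_countable_topology}"
  assumes "continuous_on (ball c r) f" "\<And>z. z \<in> ball c r \<Longrightarrow> norm (f z) \<le> K"
  shows "set_integrable lborel (ball c r) f"
proof (rule set_integrable_bound)
  show "set_integrable lborel (ball c r) (\<lambda>_. K)"
    unfolding set_integrable_def
    by (intro integrable_scaleR_left integrable_real_indicator)
      (use emeasure_bounded_finite[OF bounded_ball, of c r] in auto)
  show "set_borel_measurable lborel (ball c r) f"
    using borel_measurable_continuous_on_indicator[OF _ assms(1)]
    by (simp add: set_borel_measurable_def)
qed (use assms(2) in \<open>force intro!: AE_I2\<close>)

text \<open>A suitable rotation multiplies the integrand by -1.\<close>

lemma integral_monomials_ball:
  assumes "k \<noteq> j"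
  shows "(LINT z:ball 0 r|lborel. z ^ k * cnj z ^ j) = 0"
proof -
  define t where "t = pi / (real k - real j)"
  define w where "w = cis t"
  have "(real k - real j) * t = pi"
    using assms by (simp add: t_def)
  then have "real k * t - real j * t = pi"
    by (simp add: left_diff_distrib)
  then have "w ^ k * cnj w ^ j = cis pi"
    by (simp add: w_def Complex.DeMoivre cis_cnj cis_mult)
  then have w: "cmod w = 1" "w ^ k * cnj w ^ j \<noteq> 1"
    by (simp_all add: w_def)
  let ?F = "\<lambda>z::complex. indicator (ball 0 r) z *\<^sub>R (z ^ k * cnj z ^ j)"
  have [measurable]: "?F \<in> borel_measurable borel"
    by (intro borel_measurable_continuous_on_indicator continuous_intros) auto
  have "integral\<^sup>L lborel ?F = integral\<^sup>L (distr lborel borel ((*) w)) ?F"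
    by (simp add: lborel_distr_rotation[OF w(1)])
  also have "\<dots> = integral\<^sup>L lborel (\<lambda>z. ?F (w * z))"
    by (rule integral_distr) simp_all
  also have "(\<lambda>z. ?F (w * z)) = (\<lambda>z. (w ^ k * cnj w ^ j) * ?F z)"
    by (rule ext) (simp add: indicator_def norm_mult w(1) power_mult_distrib)
  also have "integral\<^sup>L lborel \<dots> = (w ^ k * cnj w ^ j) * integral\<^sup>L lborel ?F"
    by (rule integral_mult_right_zero)
  finally have "(1 - w ^ k * cnj w ^ j) * integral\<^sup>L lborel ?F = 0"
    by (simp add: algebra_simps)
  then show ?thesis
    using w(2) by (simp add: set_lebesgue_integral_def)
qed

text \<open>Layer-cake argument in place of polar coordinates: \<open>cmod z ^ (2 * j)\<close> is
  the integral of its radial derivative over \<open>{0..cmod z}\<close>. After exchanging integrals,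
  the inner one is the area \<open>pi * (1 - r\<^sup>2)\<close> of an annulus.\<close>

lemma integral_norm_power_unit_disc:
  "(LINT z:\<bbbD>|lborel. cmod z ^ (2 * j)) = pi / (real j + 1)"
proof (cases "j = 0")
  \<comment> \<open>Here the density \<open>?p\<close> would be 0 while the integrand is 1, so this
    case is just the area of the disc.\<close>
  case True
  then show ?thesis
    by (simp add: set_lebesgue_integral_def content_ball unit_ball_vol_2)
next
  case False
  let ?p = "\<lambda>r::real. real (2 * j) * r ^ (2 * j - 1)"
  have prim: "((\<lambda>r. r ^ (2 * j)) has_real_derivative ?p r) (at r)" for r
    using DERIV_pow[of "2 * j" r] by simp
  have inner: "(\<integral>\<^sup>+r. ennreal (?p r) * indicator {0..t} r \<partial>lborel) = ennreal (t ^ (2 * j))"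
    if "0 \<le> t" for t
  proof -
    have "(\<integral>\<^sup>+r. ennreal (?p r) * indicator {0..t} r \<partial>lborel) = ennreal (t ^ (2 * j) - 0 ^ (2 * j))"
      using that
      by (intro nn_integral_FTC_Icc) (simp_all add: has_field_derivative_at_within[OF prim, simplified])
    then show ?thesis using False by (simp add: zero_power)
  qed
  have "(\<integral>\<^sup>+z. ennreal (indicator \<bbbD> z * cmod z ^ (2 * j)) \<partial>lborel)
      = (\<integral>\<^sup>+z. (\<integral>\<^sup>+r. indicator \<bbbD> z * (ennreal (?p r) * indicator {0..cmod z} r) \<partial>lborel) \<partial>lborel)"
  proof (rule nn_integral_cong)
    fix z :: complex
    have "(\<integral>\<^sup>+r. indicator \<bbbD> z * (ennreal (?p r) * indicator {0..cmod z} r) \<partial>lborel)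
        = indicator \<bbbD> z * ennreal (cmod z ^ (2 * j))"
      by (subst nn_integral_cmult) (simp_all only: inner norm_ge_zero, measurable)
    then show "ennreal (indicator \<bbbD> z * cmod z ^ (2 * j))
        = (\<integral>\<^sup>+r. indicator \<bbbD> z * (ennreal (?p r) * indicator {0..cmod z} r) \<partial>lborel)"
      by (simp split: split_indicator)
  qed
  also have "\<dots> = (\<integral>\<^sup>+r. (\<integral>\<^sup>+z. indicator \<bbbD> (z::complex) * (ennreal (?p r) * indicator {0..cmod z} r) \<partial>lborel) \<partial>lborel)"
  proof (rule lborel_pair.Fubini')
    have "(\<lambda>(r, z::complex). indicator \<bbbD> z * (ennreal (?p r) * indicator {0..cmod z} r))
        = (\<lambda>p. if cmod (snd p) < 1 \<and> 0 \<le> fst p \<and> fst p \<le> cmod (snd p) then ennreal (?p (fst p)) else 0)"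
      by (auto simp: indicator_def)
    also have "\<dots> \<in> borel_measurable (lborel \<Otimes>\<^sub>M lborel)"
      by measurable
    finally show "(\<lambda>(r, z::complex). indicator \<bbbD> z * (ennreal (?p r) * indicator {0..cmod z} r))
        \<in> borel_measurable (lborel \<Otimes>\<^sub>M lborel)" .
  qed
  also have "\<dots> = (\<integral>\<^sup>+r. ennreal (pi * (?p r * (1 - r\<^sup>2))) * indicator {0..1} r \<partial>lborel)"
  proof (rule nn_integral_cong)
    fix r :: real
    show "(\<integral>\<^sup>+z. indicator \<bbbD> (z::complex) * (ennreal (?p r) * indicator {0..cmod z} r) \<partial>lborel)
        = ennreal (pi * (?p r * (1 - r\<^sup>2))) * indicator {0..1} r"
    proof (cases "0 \<le> r \<and> r \<le> 1")
      case True
      have "(\<integral>\<^sup>+z. indicator \<bbbD> (z::complex) * (ennreal (?p r) * indicator {0..cmod z} r) \<partial>lborel)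
          = (\<integral>\<^sup>+z. ennreal (?p r) * indicator (\<bbbD> - ball 0 r) z \<partial>lborel)"
        using True by (intro nn_integral_cong) (auto simp: indicator_def)
      also have "\<dots> = ennreal (?p r) * emeasure lborel (\<bbbD> - ball (0::complex) r)"
        by (rule nn_integral_cmult_indicator) simp
      also have "emeasure lborel (\<bbbD> - ball (0::complex) r) = emeasure lborel \<bbbD> - emeasure lborel (ball (0::complex) r)"
        using True by (intro emeasure_Diff) (auto simp: emeasure_ball)
      also have "\<dots> = ennreal (pi * (1 - r\<^sup>2))"
        using True
        by (simp add: emeasure_ball unit_ball_vol_2 ennreal_minus right_diff_distrib)
      also have "ennreal (?p r) * ennreal (pi * (1 - r\<^sup>2)) = ennreal (?p r * (pi * (1 - r\<^sup>2)))"
        using True by (intro ennreal_mult[symmetric] mult_nonneg_nonneg) (auto simp: power_le_one)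
      finally show ?thesis
        using True by (simp only: mult.left_commute[of pi]) simp
    next
      case False
      then have "indicator \<bbbD> (z::complex) * (ennreal (?p r) * indicator {0..cmod z} r) = 0" for z
        by (auto simp: indicator_def)
      then have "(\<integral>\<^sup>+z. indicator \<bbbD> (z::complex) * (ennreal (?p r) * indicator {0..cmod z} r) \<partial>lborel) = 0"
        by (simp only:) simp
      with False show ?thesis by simp
    qed
  qed
  also have "\<dots> = ennreal (pi * (1 - real j / (real j + 1)) - 0)"
  proof -
    \<comment> \<open>The coefficient \<open>j / (j + 1)\<close> is \<open>2j / (2j + 2)\<close>,
      from the antiderivative of \<open>2j * r ^ (2j + 1)\<close>.\<close>
    let ?q = "\<lambda>r::real. pi * (r ^ (2 * j) - real j / (real j + 1) * r ^ (2 * j + 2))"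
    have deriv: "(?q has_real_derivative pi * (?p r * (1 - r\<^sup>2))) (at r)" for r
    proof -
      have e: "r ^ (2 * j + 1) = r ^ (2 * j - 1) * r\<^sup>2"
        using False by (simp flip: power_add)
      have "(?q has_real_derivative pi * (?p r - real j / (real j + 1) * (real (2 * j + 2) * r ^ (2 * j + 2 - 1)))) (at r)"
        by (intro DERIV_cmult DERIV_diff prim DERIV_pow[unfolded One_nat_def[symmetric]])
      also have "real j / (real j + 1) * (real (2 * j + 2) * r ^ (2 * j + 2 - 1)) = ?p r * r\<^sup>2"
      proof -
        have "real j / (real j + 1) * (real (2 * j + 2) * r ^ (2 * j + 2 - 1)) = real (2 * j) * r ^ (2 * j + 1)"
          by (simp add: divide_simps)
        then show ?thesis by (simp only: e mult.assoc)
      qed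
      also have "pi * (?p r - ?p r * r\<^sup>2) = pi * (?p r * (1 - r\<^sup>2))"
        by (simp add: right_diff_distrib)
      finally show ?thesis .
    qed
    have "(\<integral>\<^sup>+r. ennreal (pi * (?p r * (1 - r\<^sup>2))) * indicator {0..1} r \<partial>lborel) = ennreal (?q 1 - ?q 0)"
      by (intro nn_integral_FTC_Icc has_field_derivative_at_within[OF deriv] mult_nonneg_nonneg)
        (auto simp: power_le_one)
    then show ?thesis using False by (simp add: zero_power)
  qed
  also have "pi * (1 - real j / (real j + 1)) - 0 = pi / (real j + 1)"
    by (simp add: field_simps)
  finally have nn: "(\<integral>\<^sup>+z. ennreal (indicator \<bbbD> z * cmod z ^ (2 * j)) \<partial>lborel) = ennreal (pi / (real j + 1))" .
  have "(\<lambda>z. indicator \<bbbD> z *\<^sub>R cmod z ^ (2 * j)) \<in> borel_measurable borel"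
    by (intro borel_measurable_continuous_on_indicator continuous_intros) auto
  then show ?thesis
    unfolding set_lebesgue_integral_def
    by (subst integral_eq_nn_integral) (auto simp: nn)
qed

section \<open>The Bergman space\<close>

lemma set_borel_measurable_disc:
  fixes f :: "complex \<Rightarrow> 'b::{banach, second_countable_topology}"
  assumes "continuous_on \<bbbD> f"
  shows "set_borel_measurable lborel \<bbbD> f"
  using borel_measurable_continuous_on_indicator[OF _ assms]
  by (simp add: set_borel_measurable_def)

lemma bergman_spaceD:
  assumes "f \<in> bergman_space"
  shows "f holomorphic_on \<bbbD>" "continuous_on \<bbbD> f"
    "set_integrable lborel \<bbbD> (\<lambda>z. (cmod (f z))\<^sup>2)"
  using assms by (auto simp: bergman_space_def holomorphic_on_imp_continuous_on)

lemma norm_mult_cnj_le: "norm (a * cnj b) \<le> (cmod a)\<^sup>2 + (cmod b)\<^sup>2"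
proof -
  have "0 \<le> (cmod a - cmod b)\<^sup>2" by simp
  also have "\<dots> = (cmod a)\<^sup>2 + (cmod b)\<^sup>2 - 2 * (cmod a * cmod b)"
    by (simp add: power2_diff)
  finally show ?thesis
    using mult_nonneg_nonneg[OF norm_ge_zero[of a] norm_ge_zero[of b]]
    unfolding norm_mult complex_mod_cnj by linarith
qed

lemma bergman_integrable:
  assumes "f \<in> bergman_space" "g \<in> bergman_space"
  shows "set_integrable lborel \<bbbD> (\<lambda>z. f z * cnj (g z))"
proof (rule set_integrable_bound)
  show "set_integrable lborel \<bbbD> (\<lambda>z. (cmod (f z))\<^sup>2 + (cmod (g z))\<^sup>2)"
    using assms by (intro set_integral_add) (auto dest: bergman_spaceD)
  show "set_borel_measurable lborel \<bbbD> (\<lambda>z. f z * cnj (g z))"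
    using assms by (intro set_borel_measurable_disc continuous_intros) (auto dest: bergman_spaceD)
qed (auto intro!: AE_I2 order_trans[OF norm_mult_cnj_le] abs_ge_self)

lemma bergman_spaceI_bound:
  assumes "f holomorphic_on \<bbbD>" "set_integrable lborel \<bbbD> h"
    and "\<And>z. z \<in> \<bbbD> \<Longrightarrow> (cmod (f z))\<^sup>2 \<le> (h z :: real)"
  shows "f \<in> bergman_space"
proof -
  have "set_integrable lborel \<bbbD> (\<lambda>z. (cmod (f z))\<^sup>2)"
  proof (rule set_integrable_bound[OF assms(2)])
    show "set_borel_measurable lborel \<bbbD> (\<lambda>z. (cmod (f z))\<^sup>2)"
      using assms(1) by (intro set_borel_measurable_disc continuous_intros holomorphic_on_imp_continuous_on)
  qed (use assms(3) in \<open>force intro!: AE_I2\<close>)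
  with assms(1) show ?thesis by (simp add: bergman_space_def)
qed

lemma bergman_space_bounded:
  assumes "f holomorphic_on \<bbbD>" "\<And>z. z \<in> \<bbbD> \<Longrightarrow> cmod (f z) \<le> K"
  shows "f \<in> bergman_space"
  using assms(1)
proof (rule bergman_spaceI_bound)
  show "set_integrable lborel \<bbbD> (\<lambda>_. K\<^sup>2)"
    by (rule set_integrable_ball_bounded) auto
qed (use assms(2) in \<open>auto intro!: power_mono\<close>)

lemma bergman_space_mult_bounded:
  assumes "f \<in> bergman_space" "h holomorphic_on \<bbbD>" "\<And>z. z \<in> \<bbbD> \<Longrightarrow> cmod (h z) \<le> K"
  shows "(\<lambda>z. h z * f z) \<in> bergman_space"
proof (rule bergman_spaceI_bound)
  show "(\<lambda>z. h z * f z) holomorphic_on \<bbbD>"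
    using assms by (intro holomorphic_intros) (auto dest: bergman_spaceD)
  show "set_integrable lborel \<bbbD> (\<lambda>z. K\<^sup>2 * (cmod (f z))\<^sup>2)"
    using assms by (intro set_integrable_mult_right) (auto dest: bergman_spaceD)
  show "(cmod (h z * f z))\<^sup>2 \<le> K\<^sup>2 * (cmod (f z))\<^sup>2" if "z \<in> \<bbbD>" for z
    using assms(3)[OF that] by (auto simp: norm_mult power_mult_distrib intro!: mult_right_mono power_mono)
qed

lemma bergman_space_add:
  assumes "f \<in> bergman_space" "g \<in> bergman_space"
  shows "(\<lambda>z. f z + g z) \<in> bergman_space"
proof (rule bergman_spaceI_bound)
  show "(\<lambda>z. f z + g z) holomorphic_on \<bbbD>"
    using assms by (intro holomorphic_intros) (auto dest: bergman_spaceD)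
  show "set_integrable lborel \<bbbD> (\<lambda>z. 2 * ((cmod (f z))\<^sup>2 + (cmod (g z))\<^sup>2))"
    using assms by (intro set_integrable_mult_right set_integral_add) (auto dest: bergman_spaceD)
  show "(cmod (f z + g z))\<^sup>2 \<le> 2 * ((cmod (f z))\<^sup>2 + (cmod (g z))\<^sup>2)" for z
  proof -
    have "(cmod (f z + g z))\<^sup>2 \<le> (cmod (f z) + cmod (g z))\<^sup>2"
      by (intro power_mono norm_triangle_ineq) simp
    also have "\<dots> = 2 * ((cmod (f z))\<^sup>2 + (cmod (g z))\<^sup>2) - (cmod (f z) - cmod (g z))\<^sup>2"
      by (simp add: power2_eq_square algebra_simps)
    also have "\<dots> \<le> 2 * ((cmod (f z))\<^sup>2 + (cmod (g z))\<^sup>2)" by simp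
    finally show ?thesis .
  qed
qed

lemma bergman_space_cmult:
  assumes "f \<in> bergman_space" shows "(\<lambda>z. c * f z) \<in> bergman_space"
  using assms by (rule bergman_space_mult_bounded[where K = "cmod c"]) auto

lemma bergman_space_diff:
  assumes "f \<in> bergman_space" "g \<in> bergman_space"
  shows "(\<lambda>z. f z - g z) \<in> bergman_space"
  using bergman_space_add[OF assms(1) bergman_space_cmult[OF assms(2), of "-1"]] by simp

lemma bergman_space_sum_list:
  assumes "\<And>B. B \<in> set Bs \<Longrightarrow> B \<in> bergman_space"
  shows "(\<lambda>z. \<Sum>B\<leftarrow>Bs. c B * B z) \<in> bergman_space"
  using assms
proof (induction Bs)
  case Nil
  show ?case by (simp add: bergman_space_bounded[where K = 0])
next
  case (Cons B Bs)
  then show ?case by (simp add: bergman_space_add bergman_space_cmult)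
qed

section \<open>Inner product, norm and Cauchy-Schwarz\<close>

lemma bergman_inner_add_left:
  assumes "f \<in> bergman_space" "g \<in> bergman_space" "h \<in> bergman_space"
  shows "bergman_inner (\<lambda>z. f z + g z) h = bergman_inner f h + bergman_inner g h"
  using set_integral_add(2)[OF bergman_integrable[OF assms(1,3)] bergman_integrable[OF assms(2,3)]]
  by (simp add: bergman_inner_def distrib_right add_divide_distrib)

lemma bergman_inner_cmult_left: "bergman_inner (\<lambda>z. c * f z) h = c * bergman_inner f h"
  by (simp add: bergman_inner_def mult.assoc)

lemma bergman_inner_commute: "bergman_inner f g = cnj (bergman_inner g f)"
proof -
  have "(LINT z:\<bbbD>|lborel. f z * cnj (g z)) = (LINT z:\<bbbD>|lborel. cnj (g z * cnj (f z)))"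
    by (simp add: mult.commute)
  also have "\<dots> = cnj (LINT z:\<bbbD>|lborel. g z * cnj (f z))"
    unfolding set_lebesgue_integral_def by (subst Bochner_Integration.integral_cnj[symmetric]) simp
  finally show ?thesis by (simp add: bergman_inner_def)
qed

lemma bergman_inner_diff_left:
  assumes "f \<in> bergman_space" "g \<in> bergman_space" "h \<in> bergman_space"
  shows "bergman_inner (\<lambda>z. f z - g z) h = bergman_inner f h - bergman_inner g h"
  using bergman_inner_add_left[OF assms(1) bergman_space_cmult[OF assms(2), of "-1"] assms(3)]
  by (simp add: bergman_inner_cmult_left[of "-1", simplified])

lemma bergman_inner_sum_list_left:
  assumes "\<And>B. B \<in> set Bs \<Longrightarrow> B \<in> bergman_space" "h \<in> bergman_space"
  shows "bergman_inner (\<lambda>z. \<Sum>B\<leftarrow>Bs. c B * B z) h = (\<Sum>B\<leftarrow>Bs. c B * bergman_inner B h)"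
  using assms(1)
proof (induction Bs)
  case Nil
  show ?case by (simp add: bergman_inner_def)
next
  case (Cons B Bs)
  then show ?case
    using assms(2)
    by (simp add: bergman_inner_add_left bergman_space_cmult bergman_space_sum_list bergman_inner_cmult_left)
qed

lemma bergman_norm_nonneg: "0 \<le> bergman_norm f"
  unfolding bergman_norm_def
  by (auto simp: set_lebesgue_integral_def intro!: divide_nonneg_nonneg Bochner_Integration.integral_nonneg)

lemma bergman_norm_power2: "(bergman_norm f)\<^sup>2 = (LINT z:\<bbbD>|lborel. (cmod (f z))\<^sup>2) / pi"
  unfolding bergman_norm_def
  by (auto simp: set_lebesgue_integral_def intro!: real_sqrt_pow2 divide_nonneg_nonneg Bochner_Integration.integral_nonneg)

lemma bergman_inner_self: "bergman_inner f f = of_real ((bergman_norm f)\<^sup>2)"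
  unfolding bergman_norm_power2 bergman_inner_def
  by (simp add: complex_norm_square[symmetric] set_integral_complex_of_real[symmetric] del: of_real_power)

text \<open>The right-hand side of the assumption has infimum \<open>2 * a * b\<close> over
  \<open>t\<close>. The lemma turns a weighted arithmetic-geometric inequality into a product
  bound.\<close>

lemma le_geometric_mean:
  fixes x a b :: real
  assumes "0 \<le> a" "0 \<le> b" "\<And>t. t > 0 \<Longrightarrow> 2 * x \<le> t * a\<^sup>2 + b\<^sup>2 / t"
  shows "x \<le> a * b"
proof (rule field_le_epsilon)
  fix e :: real assume "0 < e"
  show "x \<le> a * b + e"
  proof (cases "a = 0 \<or> b = 0")
    case False
    with assms have "0 < a" "0 < b" by auto
    \<comment> \<open>At \<open>t = b / a\<close> both terms equal \<open>a * b\<close>.\<close>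
    then show ?thesis
      using assms(3)[of "b / a"] \<open>0 < e\<close> by (simp add: power2_eq_square mult.commute)
  next
    case True
    then consider "a = 0" | "b = 0" by blast
    then show ?thesis
    proof cases
      case 1
      \<comment> \<open>The infimum is now only approached as \<open>t\<close> grows; the summand 1
        keeps the chosen \<open>t\<close> positive even if \<open>b = 0\<close>. The other case lets
        \<open>t\<close> tend to 0 in the same way.\<close>
      have pos: "0 < b\<^sup>2 + 1" by (simp add: add_nonneg_pos)
      have "b\<^sup>2 / ((b\<^sup>2 + 1) / e) \<le> e"
        using \<open>0 < e\<close> pos by (simp add: divide_simps)
      then show ?thesis
        using 1 assms(3)[of "(b\<^sup>2 + 1) / e"] \<open>0 < e\<close> pos by simp
    next
      case 2
      have "e / (a\<^sup>2 + 1) * a\<^sup>2 \<le> e"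
        using \<open>0 < e\<close> by (simp add: divide_simps add_nonneg_pos)
      then show ?thesis
        using 2 assms(3)[of "e / (a\<^sup>2 + 1)"] \<open>0 < e\<close> by (simp add: add_nonneg_pos)
    qed
  qed
qed

text \<open>Integrate the pointwise inequality
  \<open>2 * x * y \<le> t * x\<^sup>2 + y\<^sup>2 / t\<close> and optimize over \<open>t\<close>;
  functions of norm 0 are covered without a separate case.\<close>

lemma bergman_Cauchy_Schwarz:
  assumes f: "f \<in> bergman_space" and g: "g \<in> bergman_space"
  shows "cmod (bergman_inner f g) \<le> bergman_norm f * bergman_norm g"
proof (rule le_geometric_mean)
  fix t :: real assume t: "t > 0"
  have int: "set_integrable lborel \<bbbD> (\<lambda>z. t * (cmod (f z))\<^sup>2 + (cmod (g z))\<^sup>2 / t)"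
    using bergman_spaceD(3)[OF f] bergman_spaceD(3)[OF g]
    by (intro set_integral_add set_integrable_mult_right set_integrable_divide) auto
  have "2 * cmod (LINT z:\<bbbD>|lborel. f z * cnj (g z)) \<le> 2 * (LINT z:\<bbbD>|lborel. cmod (f z * cnj (g z)))"
    using set_integral_norm_bound[OF bergman_integrable[OF f g]] by simp
  also have "\<dots> = (LINT z:\<bbbD>|lborel. 2 * cmod (f z * cnj (g z)))"
    by simp
  also have "\<dots> \<le> (LINT z:\<bbbD>|lborel. t * (cmod (f z))\<^sup>2 + (cmod (g z))\<^sup>2 / t)"
  proof (rule set_integral_mono[OF _ int])
    show "set_integrable lborel \<bbbD> (\<lambda>z. 2 * cmod (f z * cnj (g z)))"
      using bergman_integrable[OF f g] by (intro set_integrable_mult_right set_integrable_norm)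
    fix z
    have "0 \<le> (t * cmod (f z) - cmod (g z))\<^sup>2 / t"
      using t by simp
    also have "\<dots> = t * (cmod (f z))\<^sup>2 + (cmod (g z))\<^sup>2 / t - 2 * (cmod (f z) * cmod (g z))"
      using t by (simp add: field_simps power2_eq_square)
    finally show "2 * cmod (f z * cnj (g z)) \<le> t * (cmod (f z))\<^sup>2 + (cmod (g z))\<^sup>2 / t"
      by (simp add: norm_mult)
  qed
  also have "\<dots> = t * (LINT z:\<bbbD>|lborel. (cmod (f z))\<^sup>2) + (LINT z:\<bbbD>|lborel. (cmod (g z))\<^sup>2) / t"
    using bergman_spaceD(3)[OF f] bergman_spaceD(3)[OF g]
    by (subst set_integral_add(2)) (auto intro!: set_integrable_mult_right set_integrable_divide)
  finally have "2 * cmod (LINT z:\<bbbD>|lborel. f z * cnj (g z)) / pi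
      \<le> (t * (LINT z:\<bbbD>|lborel. (cmod (f z))\<^sup>2) + (LINT z:\<bbbD>|lborel. (cmod (g z))\<^sup>2) / t) / pi"
    by (rule divide_right_mono) simp
  then show "2 * cmod (bergman_inner f g) \<le> t * (bergman_norm f)\<^sup>2 + (bergman_norm g)\<^sup>2 / t"
    by (simp add: bergman_norm_power2 bergman_inner_def norm_divide add_divide_distrib mult.commute)
qed (simp_all add: bergman_norm_nonneg)

section \<open>Gram-Schmidt orthonormalization\<close>

text \<open>This is the vector that \<open>gram_schmidt_step\<close> normalizes. Naming it lets
  orthogonality be treated apart from division by the norm.\<close>

definition bergman_residual :: "(complex \<Rightarrow> complex) list \<Rightarrow> (complex \<Rightarrow> complex) \<Rightarrow> complex \<Rightarrow> complex" where
  "bergman_residual Bs v z = v z - (\<Sum>B\<leftarrow>Bs. bergman_inner v B * B z)"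

lemma bergman_residual_in_space:
  assumes "set Bs \<subseteq> bergman_space" "v \<in> bergman_space"
  shows "bergman_residual Bs v \<in> bergman_space"
  unfolding bergman_residual_def[abs_def]
  using assms by (intro bergman_space_diff bergman_space_sum_list) auto

lemma bergman_normalize_in_space:
  assumes "u \<in> bergman_space" shows "bergman_normalize u \<in> bergman_space"
  using bergman_space_cmult[OF assms, of "1 / of_real (bergman_norm u)"]
  by (simp add: bergman_normalize_def[abs_def])

lemma bergman_inner_normalize_left:
  "bergman_inner (bergman_normalize u) h = bergman_inner u h / of_real (bergman_norm u)"
  using bergman_inner_cmult_left[of "1 / of_real (bergman_norm u)" u h]
  by (simp add: bergman_normalize_def[abs_def])

lemma bergman_inner_normalize_right:
  "bergman_inner h (bergman_normalize u) = bergman_inner h u / of_real (bergman_norm u)"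
  by (simp add: bergman_inner_commute[of h] bergman_inner_normalize_left)

text \<open>Normalizing a vector of norm 0 gives 0, so Gram-Schmidt needs no linear independence below.\<close>

lemma bergman_inner_normalize_self:
  "bergman_inner (bergman_normalize u) (bergman_normalize u) = (if bergman_norm u = 0 then 0 else 1)"
  unfolding bergman_inner_normalize_left bergman_inner_normalize_right
  by (simp add: bergman_inner_self power2_eq_square)

lemma bergman_inner_eq_0_of_norm_0:
  assumes "h \<in> bergman_space" "u \<in> bergman_space" "bergman_norm u = 0"
  shows "bergman_inner h u = 0"
  using bergman_Cauchy_Schwarz[OF assms(1,2)] assms(3) by simp

lemma gram_schmidt_snoc:
  "gram_schmidt_orthonormalization (vs @ [v]) =
     gram_schmidt_orthonormalization vs @
     [bergman_normalize (bergman_residual (gram_schmidt_orthonormalization vs) v)]"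
  by (simp add: gram_schmidt_orthonormalization_def gram_schmidt_step_def bergman_residual_def[abs_def])

lemma gram_schmidt_Nil: "gram_schmidt_orthonormalization [] = []"
  by (simp add: gram_schmidt_orthonormalization_def)

lemma length_gram_schmidt: "length (gram_schmidt_orthonormalization vs) = length vs"
  by (induction vs rule: rev_induct) (simp_all add: gram_schmidt_snoc gram_schmidt_Nil)

lemma set_gram_schmidt_subset:
  assumes "set vs \<subseteq> bergman_space"
  shows "set (gram_schmidt_orthonormalization vs) \<subseteq> bergman_space"
  using assms
  by (induction vs rule: rev_induct)
    (auto simp: gram_schmidt_snoc gram_schmidt_Nil intro!: bergman_normalize_in_space bergman_residual_in_space)

text \<open>Induction on the list: one more vector \<open>b\<close> subtracts one more component,
  and \<open>b\<close> is orthogonal to the earlier vectors. Against \<open>b\<close> itself the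
  residual cancels because either \<open>b\<close> has norm 1, or \<open>b\<close> is a degenerate
  zero vector and \<open>bergman_inner v b = 0\<close>.\<close>

lemma bergman_inner_residual_gram_schmidt:
  assumes "set vs \<subseteq> bergman_space" "v \<in> bergman_space" "B \<in> set (gram_schmidt_orthonormalization vs)"
  shows "bergman_inner (bergman_residual (gram_schmidt_orthonormalization vs) v) B = 0"
  using assms
proof (induction vs arbitrary: v B rule: rev_induct)
  case Nil
  then show ?case by (simp add: gram_schmidt_Nil)
next
  case (snoc w vs)
  let ?Bs = "gram_schmidt_orthonormalization vs"
  define b where "b = bergman_normalize (bergman_residual ?Bs w)"
  have w: "w \<in> bergman_space" and vs: "set vs \<subseteq> bergman_space" and v: "v \<in> bergman_space"
    using snoc.prems by auto
  have Bs: "set ?Bs \<subseteq> bergman_space"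
    using vs by (rule set_gram_schmidt_subset)
  have b: "b \<in> bergman_space"
    unfolding b_def using Bs w by (intro bergman_normalize_in_space bergman_residual_in_space)
  have r: "bergman_residual ?Bs v \<in> bergman_space"
    using Bs v by (rule bergman_residual_in_space)
  have res: "bergman_residual (?Bs @ [b]) v = (\<lambda>z. bergman_residual ?Bs v z - bergman_inner v b * b z)"
    by (simp add: bergman_residual_def fun_eq_iff)
  have b_orth: "bergman_inner b C = 0" if "C \<in> set ?Bs" for C
    unfolding b_def bergman_inner_normalize_left using snoc.IH[OF vs w that] by simp
  have Bs_b: "bergman_inner C b = 0" if "C \<in> set ?Bs" for C
    using b_orth[OF that] bergman_inner_commute[of C b] by simp
  have eq: "bergman_inner (bergman_residual (?Bs @ [b]) v) C
      = bergman_inner (bergman_residual ?Bs v) C - bergman_inner v b * bergman_inner b C"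
    if "C \<in> bergman_space" for C
    unfolding res using that r b
    by (simp add: bergman_inner_diff_left bergman_space_cmult bergman_inner_cmult_left)
  have "bergman_inner (bergman_residual (?Bs @ [b]) v) B = 0"
  proof (cases "B \<in> set ?Bs")
    case True
    then show ?thesis
      using Bs by (subst eq) (auto simp: snoc.IH[OF vs v] b_orth)
  next
    case False
    then have B: "B = b"
      using snoc.prems by (simp add: gram_schmidt_snoc b_def)
    have "bergman_inner (bergman_residual ?Bs v) b = bergman_inner v b - bergman_inner (\<lambda>z. \<Sum>B\<leftarrow>?Bs. bergman_inner v B * B z) b"
      unfolding bergman_residual_def[abs_def]
      using v b Bs by (intro bergman_inner_diff_left bergman_space_sum_list) auto
    also have "bergman_inner (\<lambda>z. \<Sum>B\<leftarrow>?Bs. bergman_inner v B * B z) b = 0"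
      using b Bs by (subst bergman_inner_sum_list_left) (auto simp: Bs_b intro!: sum_list_0[THEN trans[rotated]] cong: map_cong)
    finally have "bergman_inner (bergman_residual ?Bs v) b = bergman_inner v b" by simp
    moreover have "bergman_inner b b = 1 \<or> bergman_inner v b = 0"
    proof (cases "bergman_norm (bergman_residual ?Bs w) = 0")
      case True
      then show ?thesis by (simp add: b_def bergman_inner_normalize_right)
    next
      case False
      then show ?thesis unfolding b_def bergman_inner_normalize_self by simp
    qed
    ultimately show ?thesis
      unfolding B using b by (subst eq) auto
  qed
  then show ?case
    by (simp add: gram_schmidt_snoc b_def)
qed

lemma bergman_inner_residual_right:
  assumes "set Bs \<subseteq> bergman_space" "v \<in> bergman_space" "q \<in> bergman_space"
    and "\<And>B. B \<in> set Bs \<Longrightarrow> bergman_inner q B = 0"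
  shows "bergman_inner q (bergman_residual Bs v) = bergman_inner q v"
proof -
  have "bergman_inner (bergman_residual Bs v) q = bergman_inner v q - bergman_inner (\<lambda>z. \<Sum>B\<leftarrow>Bs. bergman_inner v B * B z) q"
    unfolding bergman_residual_def[abs_def]
    using assms by (intro bergman_inner_diff_left bergman_space_sum_list) auto
  also have "bergman_inner (\<lambda>z. \<Sum>B\<leftarrow>Bs. bergman_inner v B * B z) q = (\<Sum>B\<leftarrow>Bs. bergman_inner v B * bergman_inner B q)"
    using assms by (intro bergman_inner_sum_list_left) auto
  also have "\<dots> = (\<Sum>B\<leftarrow>Bs. 0)"
    using assms(4) by (intro arg_cong[where f = sum_list] map_cong) (auto simp: bergman_inner_commute[of _ q])
  finally show ?thesis
    by (metis bergman_inner_commute diff_zero sum_list_0)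
qed

text \<open>Each residual differs from its input by a combination of earlier vectors, so both lists
  have the same annihilator. If a residual has norm 0, Cauchy-Schwarz makes its pairing with
  \<open>q\<close> vanish, so the equivalence survives linear dependence.\<close>

lemma gram_schmidt_orthogonal_iff:
  assumes "set vs \<subseteq> bergman_space" "q \<in> bergman_space"
  shows "(\<forall>B\<in>set (gram_schmidt_orthonormalization vs). bergman_inner q B = 0)
    \<longleftrightarrow> (\<forall>v\<in>set vs. bergman_inner q v = 0)"
  using assms(1)
proof (induction vs rule: rev_induct)
  case Nil
  then show ?case by (simp add: gram_schmidt_Nil)
next
  case (snoc w vs)
  let ?Bs = "gram_schmidt_orthonormalization vs"
  let ?u = "bergman_residual ?Bs w"
  have Bs: "set ?Bs \<subseteq> bergman_space"
    using snoc.prems by (intro set_gram_schmidt_subset) auto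
  have u: "?u \<in> bergman_space"
    using Bs snoc.prems by (intro bergman_residual_in_space) auto
  have "bergman_inner q (bergman_normalize ?u) = 0 \<longleftrightarrow> bergman_inner q ?u = 0"
    using bergman_inner_eq_0_of_norm_0[OF assms(2) u]
    by (auto simp: bergman_inner_normalize_right)
  moreover have "bergman_inner q ?u = bergman_inner q w" if "\<forall>B\<in>set ?Bs. bergman_inner q B = 0"
    using Bs assms(2) snoc.prems that by (intro bergman_inner_residual_right) auto
  ultimately show ?case
    using snoc by (auto simp: gram_schmidt_snoc)
qed

section \<open>Zeros with multiplicity\<close>

text \<open>The polynomial \<open>P\<close> of the overview.\<close>

definition root_poly :: "complex list \<Rightarrow> complex \<Rightarrow> complex" where
  "root_poly as z = (\<Prod>a\<leftarrow>as. z - a)"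

text \<open>The number \<open>c(b)\<close> of the overview: the \<open>m\<close>-th derivative of
  \<open>(z - b) ^ m * r z\<close> at \<open>b\<close> is \<open>fact m * r b\<close>, and
  \<open>r\<close> collects here the factors with roots other than \<open>b\<close>.\<close>

definition root_factor :: "complex list \<Rightarrow> complex \<Rightarrow> complex" where
  "root_factor as b = fact (count_list as b) * root_poly (filter (\<lambda>a. a \<noteq> b) as) b"

lemma root_poly_append: "root_poly (as @ bs) z = root_poly as z * root_poly bs z"
  by (simp add: root_poly_def)

lemma root_poly_holomorphic [holomorphic_intros]: "root_poly as holomorphic_on S"
  unfolding root_poly_def[abs_def]
  by (induction as) (auto intro!: holomorphic_intros)

lemma root_poly_eq_0_iff: "root_poly as z = 0 \<longleftrightarrow> z \<in> set as"
  by (induction as) (auto simp: root_poly_def)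

lemma root_poly_bound:
  assumes "set as \<subseteq> \<bbbD>" "z \<in> \<bbbD>"
  shows "cmod (root_poly as z) \<le> 2 ^ length as"
  using assms(1)
proof (induction as)
  case (Cons a as)
  have "cmod (z - a) \<le> 2"
    using norm_triangle_ineq4[of z a] Cons.prems assms(2) by simp
  with Cons show ?case
    by (auto simp: root_poly_def norm_mult intro!: mult_mono)
qed (simp add: root_poly_def)

lemma root_factor_nonzero: "root_factor as b \<noteq> 0"
  by (simp add: root_factor_def root_poly_eq_0_iff)

lemma root_poly_split:
  "root_poly as z = (z - b) ^ count_list as b * root_poly (filter (\<lambda>a. a \<noteq> b) as) z"
  by (induction as) (auto simp: root_poly_def)

text \<open>In the Leibniz rule only two terms survive for a linear factor. For \<open>n = 0\<close>
  the truncated index \<open>n - 1\<close> is harmless, since its coefficient is 0.\<close>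

lemma higher_deriv_linear_mult:
  assumes "open S" "s holomorphic_on S" "z \<in> S"
  shows "(deriv ^^ n) (\<lambda>z. (z - b) * s z) z = (z - b) * (deriv ^^ n) s z + of_nat n * (deriv ^^ (n - 1)) s z"
  using assms(3)
proof (induction n arbitrary: z)
  case 0
  then show ?case by simp
next
  case (Suc n)
  have der: "((deriv ^^ k) s has_field_derivative (deriv ^^ Suc k) s z) (at z)" for k
    using has_field_derivative_higher_deriv[OF assms(2,1) Suc.prems] .
  have low: "((\<lambda>z. of_nat n * (deriv ^^ (n - 1)) s z) has_field_derivative of_nat n * (deriv ^^ n) s z) (at z)"
  proof (cases n)
    case (Suc k)
    then show ?thesis using DERIV_cmult[OF der[of k], of "of_nat n"] by simp
  qed simp
  have "((\<lambda>z. (z - b) * (deriv ^^ n) s z + of_nat n * (deriv ^^ (n - 1)) s z)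
      has_field_derivative ((z - b) * (deriv ^^ Suc n) s z + 1 * (deriv ^^ n) s z) + of_nat n * (deriv ^^ n) s z) (at z)"
    by (intro DERIV_add low DERIV_mult'[OF _ der]) (auto intro!: derivative_eq_intros)
  then have "((deriv ^^ n) (\<lambda>z. (z - b) * s z)
      has_field_derivative ((z - b) * (deriv ^^ Suc n) s z + 1 * (deriv ^^ n) s z) + of_nat n * (deriv ^^ n) s z) (at z)"
    by (rule has_field_derivative_transform_within_open[OF _ assms(1) Suc.prems]) (simp add: Suc.IH)
  then show ?case
    by (simp add: DERIV_imp_deriv algebra_simps)
qed

text \<open>Peel off one factor \<open>z - b\<close> at a time; at the point \<open>b\<close> only
  the second term of \<open>higher_deriv_linear_mult\<close> remains.\<close>

lemma higher_deriv_power_mult: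
  assumes "open S" "r holomorphic_on S" "b \<in> S"
  shows "(deriv ^^ m) (\<lambda>z. (z - b) ^ m * r z) b = fact m * r b"
proof (induction m)
  case (Suc m)
  have "(deriv ^^ Suc m) (\<lambda>z. (z - b) * ((z - b) ^ m * r z)) b
      = of_nat (Suc m) * (deriv ^^ m) (\<lambda>z. (z - b) ^ m * r z) b"
    using assms by (subst higher_deriv_linear_mult[OF assms(1)]) (auto intro!: holomorphic_intros)
  with Suc show ?case by (simp add: mult.assoc del: funpow.simps)
qed simp

lemma higher_deriv_root_poly_mult:
  assumes "open S" "h holomorphic_on S" "b \<in> S"
  shows "(deriv ^^ count_list as b) (\<lambda>z. root_poly as z * h z) b = root_factor as b * h b"
proof -
  have "(deriv ^^ count_list as b) (\<lambda>z. (z - b) ^ count_list as b * (root_poly (filter (\<lambda>a. a \<noteq> b) as) z * h z)) b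
      = fact (count_list as b) * (root_poly (filter (\<lambda>a. a \<noteq> b) as) b * h b)"
    using assms by (intro higher_deriv_power_mult) (auto intro!: holomorphic_intros)
  then show ?thesis
    by (simp add: root_poly_split[of as _ b] root_factor_def mult.assoc)
qed

lemma occurrence_append:
  assumes "i < length as" shows "occurrence (as @ bs) i = occurrence as i"
  using assms by (simp add: occurrence_def nth_append)

lemma occurrence_take:
  assumes "i < length as" shows "occurrence as i - 1 = count_list (take i as) (as ! i)"
  using assms by (simp add: occurrence_def take_Suc_conv_app_nth)

lemma occurrence_snoc: "occurrence (as @ [b]) (length as) - 1 = count_list as b"
  by (simp add: occurrence_def)

text \<open>The order of the derivative is the multiplicity of \<open>as ! i\<close> among the
  earlier entries only. Those factors are used up, and the factor of entry \<open>i\<close> itself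
  remains and vanishes.\<close>

lemma higher_deriv_root_poly_mult_eq_0:
  assumes "open S" "h holomorphic_on S" "as ! i \<in> S" "i < length as"
  shows "(deriv ^^ (occurrence as i - 1)) (\<lambda>z. root_poly as z * h z) (as ! i) = 0"
proof -
  have "(deriv ^^ count_list (take i as) (as ! i))
      (\<lambda>z. root_poly (take i as) z * (root_poly (drop i as) z * h z)) (as ! i)
      = root_factor (take i as) (as ! i) * (root_poly (drop i as) (as ! i) * h (as ! i))"
    using assms by (intro higher_deriv_root_poly_mult) (auto intro!: holomorphic_intros)
  moreover have "root_poly as z = root_poly (take i as) z * root_poly (drop i as) z" for z
    using root_poly_append[of "take i as" "drop i as"] by simp
  moreover have "root_poly (drop i as) (as ! i) = 0"
    using assms(4) by (simp add: root_poly_eq_0_iff flip: Cons_nth_drop_Suc)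
  ultimately show ?thesis
    unfolding occurrence_take[OF assms(4)] by (simp add: mult.assoc)
qed

text \<open>Divide out one root at a time. If \<open>q\<close> is already
  \<open>root_poly as * k\<close>, the next condition reads
  \<open>root_factor as a * k a = 0\<close>, so \<open>k a = 0\<close> and
  \<open>k z / (z - a)\<close> has a removable singularity.\<close>

lemma root_poly_factorization:
  assumes "open S" "q holomorphic_on S" "set as \<subseteq> S"
    and "\<And>i. i < length as \<Longrightarrow> (deriv ^^ (occurrence as i - 1)) q (as ! i) = 0"
  obtains h where "h holomorphic_on S" "\<And>z. z \<in> S \<Longrightarrow> q z = root_poly as z * h z"
proof -
  have "\<exists>h. h holomorphic_on S \<and> (\<forall>z\<in>S. q z = root_poly as z * h z)"
    using assms(3,4)
  proof (induction as rule: rev_induct)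
    case Nil
    with assms(2) show ?case by (auto simp: root_poly_def)
  next
    case (snoc a as)
    have a: "a \<in> S" and as: "set as \<subseteq> S" using snoc.prems by auto
    have "(deriv ^^ (occurrence as i - 1)) q (as ! i) = 0" if "i < length as" for i
      using snoc.prems(2)[of i] that by (simp add: occurrence_append nth_append)
    then obtain k where k: "k holomorphic_on S" "\<And>z. z \<in> S \<Longrightarrow> q z = root_poly as z * k z"
      using snoc.IH[OF as] by blast
    have "root_factor as a * k a = (deriv ^^ count_list as a) (\<lambda>z. root_poly as z * k z) a"
      using assms(1) k a by (intro higher_deriv_root_poly_mult[symmetric])
    also have "\<dots> = (deriv ^^ count_list as a) q a"
      using assms(1,2) k a
      by (intro higher_deriv_transform_within_open) (auto intro!: holomorphic_intros)
    also have "\<dots> = 0"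
      using snoc.prems(2)[of "length as"] by (simp add: occurrence_snoc[simplified])
    finally have "k a = 0" using root_factor_nonzero by simp
    define h where "h = (\<lambda>z. if z = a then deriv k a else (k z - k a) / (z - a))"
    have "h holomorphic_on S"
      unfolding h_def using k(1) a assms(1) by (intro pole_lemma) (auto simp: interior_open)
    moreover have "q z = root_poly (as @ [a]) z * h z" if "z \<in> S" for z
      using k(2)[OF that] \<open>k a = 0\<close> by (simp add: h_def root_poly_append) (simp add: root_poly_def)
    ultimately show ?case by blast
  qed
  with that show thesis by blast
qed

section \<open>The reproducing property\<close>

text \<open>Closed form of the \<open>m\<close>-th derivative of \<open>bergman_kernel w z\<close>
  in the variable \<open>cnj w\<close>.\<close>

definition kernel_deriv :: "nat \<Rightarrow> complex \<Rightarrow> complex \<Rightarrow> complex" where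
  "kernel_deriv m w z = fact (Suc m) * z ^ m / (1 - cnj w * z) ^ (m + 2)"

lemma disc_mult_ne_1: 
  assumes "w \<in> \<bbbD>" "z \<in> \<bbbD>" shows "cmod (cnj w * z) < 1" "1 - cnj w * z \<noteq> 0"
proof -
  show *: "cmod (cnj w * z) < 1"
    using assms mult_strict_mono[of "cmod w" 1 "cmod z" 1] by (simp add: norm_mult)
  then show "1 - cnj w * z \<noteq> 0" by auto
qed

text \<open>The real derivative of \<open>g\<close> is \<open>h \<mapsto> D * cnj h\<close>, on
  which the operator yields \<open>(D + \<i> * (- \<i> * D)) / 2 = D\<close>.\<close>

lemma wirtinger_cnj_of_holomorphic:
  assumes "(\<phi> has_field_derivative D) (at (cnj w))" "open S" "w \<in> S"
    and "\<And>v. v \<in> S \<Longrightarrow> g v = \<phi> (cnj v)"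
  shows "wirtinger_cnj g w = D"
proof -
  have "((\<lambda>v. \<phi> (cnj v)) has_derivative (\<lambda>h. D * cnj h)) (at w)"
    using has_derivative_compose[OF bounded_linear.has_derivative[OF bounded_linear_cnj has_derivative_ident]
        assms(1)[unfolded has_field_derivative_def]]
    by simp
  then have "(g has_derivative (\<lambda>h. D * cnj h)) (at w)"
    by (rule has_derivative_transform_within_open[OF _ assms(2,3)]) (simp add: assms(4))
  then have "frechet_derivative g (at w) = (\<lambda>h. D * cnj h)"
    by (metis frechet_derivative_at)
  then show ?thesis
    by (simp add: wirtinger_cnj_def mult.left_commute[of \<i>])
qed

lemma wirtinger_cnj_iterate_kernel:
  assumes "z \<in> \<bbbD>" "w \<in> \<bbbD>"
  shows "(wirtinger_cnj ^^ m) (\<lambda>w. bergman_kernel w z) w = kernel_deriv m w z"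
  using assms(2)
proof (induction m arbitrary: w)
  case 0
  show ?case by (simp add: kernel_deriv_def bergman_kernel_def power2_eq_square)
next
  case (Suc m)
  have nz: "1 - cnj w * z \<noteq> 0"
    using disc_mult_ne_1(2)[OF Suc.prems assms(1)] .
  have "((\<lambda>v. fact (Suc m) * z ^ m / (1 - v * z) ^ (m + 2)) has_field_derivative kernel_deriv (Suc m) w z) (at (cnj w))"
  proof -
    have "((\<lambda>v. 1 - v * z) has_field_derivative - z) (at (cnj w))"
      by (auto intro!: derivative_eq_intros)
    then have "((\<lambda>v. (1 - v * z) ^ (m + 2)) has_field_derivative
        of_nat (m + 2) * (- z * (1 - cnj w * z) ^ (m + 2 - 1))) (at (cnj w))"
      using DERIV_power[of "\<lambda>v. 1 - v * z" "- z" "cnj w" UNIV "m + 2"] by simp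
    then have "((\<lambda>v. fact (Suc m) * z ^ m / (1 - v * z) ^ (m + 2)) has_field_derivative
        (0 * (1 - cnj w * z) ^ (m + 2) - fact (Suc m) * z ^ m * (of_nat (m + 2) * (- z * (1 - cnj w * z) ^ (m + 2 - 1))))
          / ((1 - cnj w * z) ^ (m + 2) * (1 - cnj w * z) ^ (m + 2))) (at (cnj w))"
      using nz by (intro DERIV_divide DERIV_const) auto
    also have "(0 * (1 - cnj w * z) ^ (m + 2) - fact (Suc m) * z ^ m * (of_nat (m + 2) * (- z * (1 - cnj w * z) ^ (m + 2 - 1))))
          / ((1 - cnj w * z) ^ (m + 2) * (1 - cnj w * z) ^ (m + 2)) = kernel_deriv (Suc m) w z"
    proof -
      define d where "d = 1 - cnj w * z"
      have "fact (Suc (Suc m)) = (of_nat (m + 2) * fact (Suc m) :: complex)"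
        by (simp add: algebra_simps)
      then show ?thesis
        using nz unfolding kernel_deriv_def d_def[symmetric]
        by (simp add: divide_simps del: fact_Suc) 
    qed
    finally show ?thesis .
  qed
  then show ?case
    \<comment> \<open>The induction hypothesis holds for every \<open>w\<close> in the open disc, so
      the closed form may be differentiated.\<close>
    unfolding funpow.simps comp_def
    using Suc by (intro wirtinger_cnj_of_holomorphic[where S = \<bbbD>]) (auto simp: kernel_deriv_def)
qed

lemma gen_kernel_eq:
  assumes "as ! j \<in> \<bbbD>" "z \<in> \<bbbD>"
  shows "gen_kernel as j z = kernel_deriv (occurrence as j - 1) (as ! j) z"
  unfolding gen_kernel_def using assms by (intro wirtinger_cnj_iterate_kernel)

section \<open>Power series and termwise integration\<close>

text \<open>Newton's series for the exponent \<open>- (m + 2)\<close>, with its binomial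
  coefficients written by factorials. It expands \<open>kernel_deriv\<close> into powers.\<close>

lemma negative_binomial_series:
  fixes x :: complex
  assumes "cmod x < 1"
  shows "(\<lambda>n. fact (n + Suc m) / fact n * x ^ n) sums (fact (Suc m) / (1 - x) ^ (m + 2))"
proof -
  have "(\<lambda>n. (-1) ^ n * ((of_nat (m + 2) + of_nat n - 1) gchoose n) * (- x) ^ n) sums (1 + (- x)) powr (- of_nat (m + 2))"
    using assms by (intro one_plus_neg_powr_powser) simp
  also have "(1 + (- x)) powr (- of_nat (m + 2)) = 1 / (1 - x) ^ (m + 2)"
    using assms by (subst powr_minus, subst powr_nat') (auto simp: divide_inverse)
  also have "(\<lambda>n. (-1) ^ n * ((of_nat (m + 2) + of_nat n - 1) gchoose n) * (- x) ^ n)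
      = (\<lambda>n. fact (n + Suc m) / (fact n * fact (Suc m)) * x ^ n)"
  proof
    fix n
    have "of_nat (m + 2) + of_nat n - 1 = (of_nat (n + Suc m) :: complex)"
      by simp
    then have "((of_nat (m + 2) + of_nat n - 1) gchoose n) = (of_nat ((n + Suc m) choose n) :: complex)"
      by (simp only: binomial_gbinomial)
    also have "\<dots> = fact (n + Suc m) / (fact n * fact (Suc m))"
      by (subst binomial_fact) (simp_all del: fact_Suc)
    finally have e: "((of_nat (m + 2) + of_nat n - 1) gchoose n) = (fact (n + Suc m) / (fact n * fact (Suc m)) :: complex)" .
    have "(-1) ^ n * (- x) ^ n = x ^ n"
      by (simp flip: power_mult_distrib)
    then show "(-1) ^ n * ((of_nat (m + 2) + of_nat n - 1) gchoose n) * (- x) ^ n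
        = fact (n + Suc m) / (fact n * fact (Suc m)) * x ^ n"
      unfolding e by (simp add: mult_ac del: fact_Suc)
  qed
  finally have "(\<lambda>n. fact (Suc m) * (fact (n + Suc m) / (fact n * fact (Suc m)) * x ^ n)) sums (fact (Suc m) * (1 / (1 - x) ^ (m + 2)))"
    by (rule sums_mult)
  then show ?thesis
    by (simp add: divide_simps mult_ac del: fact_Suc)
qed

text \<open>The bound separates the index from the point. Summability of \<open>c\<close> then gives
  both absolute convergence at each point and summability of the integrals of the norms.\<close>

lemma sums_set_integral_dominated:
  fixes f :: "nat \<Rightarrow> 'a \<Rightarrow> 'b::{banach, second_countable_topology}" and h :: "'a \<Rightarrow> real"
  assumes int: "\<And>j. set_integrable M A (f j)" and h: "set_integrable M A h"
    and bound: "\<And>j x. x \<in> A \<Longrightarrow> norm (f j x) \<le> c j * h x"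
    and c: "summable c" and sums: "\<And>x. x \<in> A \<Longrightarrow> (\<lambda>j. f j x) sums F x"
  shows "(\<lambda>j. LINT x:A|M. f j x) sums (LINT x:A|M. F x)"
proof -
  let ?f = "\<lambda>j x. indicator A x *\<^sub>R f j x"
  have nb: "norm (?f j x) \<le> c j * (indicator A x *\<^sub>R h x)" for j x
    using bound by (auto simp: indicator_def)
  have "(\<lambda>j. integral\<^sup>L M (?f j)) sums (\<integral>x. (\<Sum>j. ?f j x) \<partial>M)"
  proof (rule sums_integral)
    show "integrable M (?f j)" for j
      using int[of j] by (simp add: set_integrable_def)
    show "AE x in M. summable (\<lambda>j. norm (?f j x))"
      by (intro AE_I2 summable_comparison_test'[OF summable_mult2[OF c]]) (use nb in auto)
    show "summable (\<lambda>j. \<integral>x. norm (?f j x) \<partial>M)"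
    proof (rule summable_comparison_test'[OF summable_mult2[OF c]])
      fix j
      have "norm (\<integral>x. norm (?f j x) \<partial>M) = (\<integral>x. norm (?f j x) \<partial>M)"
        by (simp add: Bochner_Integration.integral_nonneg)
      also have "\<dots> \<le> (\<integral>x. c j * (indicator A x *\<^sub>R h x) \<partial>M)"
        using int[of j] h nb
        by (intro integral_mono integrable_norm integrable_mult_right) (auto simp: set_integrable_def)
      also have "\<dots> = c j * (\<integral>x. indicator A x *\<^sub>R h x \<partial>M)"
        by (rule integral_mult_right_zero)
      finally show "norm (\<integral>x. norm (?f j x) \<partial>M) \<le> c j * (\<integral>x. indicator A x *\<^sub>R h x \<partial>M)" .
    qed
  qed
  moreover have "(\<Sum>j. ?f j x) = indicator A x *\<^sub>R F x" for x
    using sums[of x] by (auto simp: indicator_def sums_unique[symmetric])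
  ultimately show ?thesis
    by (simp add: set_lebesgue_integral_def)
qed

text \<open>A power series that converges at a radius \<open>t\<close> strictly between
  \<open>r\<close> and \<open>R\<close> converges absolutely at \<open>r\<close>.\<close>

lemma norm_taylor_coeffs_summable:
  assumes "q holomorphic_on ball 0 R" "0 \<le> r" "r < R"
  shows "summable (\<lambda>j. cmod ((deriv ^^ j) q 0 / fact j) * r ^ j)"
proof -
  define t where "t = (r + R) / 2"
  have t: "r < t" "t < R" using assms(3) by (auto simp: t_def)
  have "(\<lambda>j. (deriv ^^ j) q 0 / fact j * (of_real t - 0) ^ j) sums q (of_real t)"
    using assms t by (intro holomorphic_power_series) auto
  then have "summable (\<lambda>j. (deriv ^^ j) q 0 / fact j * of_real t ^ j)"
    by (simp add: sums_iff)
  then have "summable (\<lambda>j. norm ((deriv ^^ j) q 0 / fact j * of_real r ^ j))"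
    by (rule powser_insidea) (use assms t in simp)
  then show ?thesis
    using assms(2) by (simp add: norm_mult norm_power norm_divide)
qed

text \<open>Integrate the Taylor series termwise, which is legitimate as \<open>r < R\<close>;
  orthogonality of monomials leaves only the term \<open>j = k\<close>. For \<open>k = 0\<close>
  this is the mean value property.\<close>

lemma holomorphic_moment_ball:
  assumes q: "q holomorphic_on ball 0 R" and r: "0 < r" "r < R"
  shows "(LINT z:ball 0 r|lborel. q z * cnj z ^ k)
    = (deriv ^^ k) q 0 / fact k * of_real (LINT z:ball 0 r|lborel. cmod z ^ (2 * k))"
proof -
  define c where "c j = (deriv ^^ j) q 0 / fact j" for j
  have int: "set_integrable lborel (ball 0 r) (\<lambda>z::complex. c j * (z ^ j * cnj z ^ k))" for j
  proof (rule set_integrable_ball_bounded)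
    show "norm (c j * (z ^ j * cnj z ^ k)) \<le> cmod (c j) * (r ^ j * r ^ k)" if "z \<in> ball 0 r" for z
      using that r by (auto simp: norm_mult norm_power intro!: mult_left_mono mult_mono power_mono)
  qed (intro continuous_intros)
  have "(\<lambda>j. LINT z:ball 0 r|lborel. c j * (z ^ j * cnj z ^ k)) sums (LINT z:ball 0 r|lborel. q z * cnj z ^ k)"
  proof (rule sums_set_integral_dominated[OF int, where h = "\<lambda>_. r ^ k" and c = "\<lambda>j. cmod (c j) * r ^ j"])
    show "set_integrable lborel (ball (0::complex) r) (\<lambda>_. r ^ k)"
      by (rule set_integrable_ball_bounded[where K = "\<bar>r ^ k\<bar>"]) auto
    show "norm (c j * (z ^ j * cnj z ^ k)) \<le> cmod (c j) * r ^ j * r ^ k" if "z \<in> ball 0 r" for j z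
      using that r by (auto simp: norm_mult norm_power mult.assoc intro!: mult_left_mono mult_mono power_mono)
    show "summable (\<lambda>j. cmod (c j) * r ^ j)"
      unfolding c_def using q r by (intro norm_taylor_coeffs_summable) auto
    fix z :: complex assume z: "z \<in> ball 0 r"
    have "(\<lambda>j. c j * (z - 0) ^ j) sums q z"
      unfolding c_def using q r z by (intro holomorphic_power_series) auto
    then have "(\<lambda>j. c j * (z - 0) ^ j * cnj z ^ k) sums (q z * cnj z ^ k)"
      by (rule sums_mult2)
    then show "(\<lambda>j. c j * (z ^ j * cnj z ^ k)) sums (q z * cnj z ^ k)"
      by (simp add: mult.assoc)
  qed
  moreover have "(\<lambda>j. LINT z:ball 0 r|lborel. c j * (z ^ j * cnj z ^ k))
      = (\<lambda>j. if j = k then c k * of_real (LINT z:ball 0 r|lborel. cmod z ^ (2 * k)) else 0)"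
  proof
    fix j
    have "(LINT z:ball 0 r|lborel. z ^ k * cnj z ^ k) = of_real (LINT z:ball 0 r|lborel. cmod z ^ (2 * k))"
    proof -
      have "z ^ k * cnj z ^ k = of_real (cmod z ^ (2 * k))" for z
        by (simp only: power_mult_distrib[symmetric] complex_norm_square[symmetric] of_real_power power_mult)
      then show ?thesis
        by (simp only: set_integral_complex_of_real)
    qed
    then show "(LINT z:ball 0 r|lborel. c j * (z ^ j * cnj z ^ k))
        = (if j = k then c k * of_real (LINT z:ball 0 r|lborel. cmod z ^ (2 * k)) else 0)"
      by (simp add: integral_monomials_ball)
  qed
  ultimately have "(\<lambda>j. if j = k then c k * of_real (LINT z:ball 0 r|lborel. cmod z ^ (2 * k)) else 0)
      sums (LINT z:ball 0 r|lborel. q z * cnj z ^ k)"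
    by simp
  with sums_single[of k "\<lambda>_. c k * of_real (LINT z:ball 0 r|lborel. cmod z ^ (2 * k))"]
  show ?thesis
    unfolding c_def by (rule sums_unique2[symmetric])
qed

text \<open>Termwise integration works on balls of radius below 1, so integrals over the disc are
  obtained as limits. The offset 2 makes every radius positive, as
  \<open>holomorphic_moment_ball\<close> requires.\<close>

lemma disc_eq_UN_balls: "\<bbbD> = (\<Union>n. ball 0 (1 - 1 / (real n + 2)))"
proof (intro equalityI subsetI)
  fix z :: complex assume z: "z \<in> \<bbbD>"
  then obtain n where "inverse (real (Suc n)) < 1 - cmod z"
    using reals_Archimedean[of "1 - cmod z"] by auto
  moreover have "1 / (real n + 2) \<le> inverse (real (Suc n))"
    by (simp add: field_simps)
  ultimately have "z \<in> ball 0 (1 - 1 / (real n + 2))" by simp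
  then show "z \<in> (\<Union>n. ball 0 (1 - 1 / (real n + 2)))" by blast
next
  fix z :: complex assume "z \<in> (\<Union>n. ball 0 (1 - 1 / (real n + 2)))"
  then obtain n :: nat where "cmod z < 1 - 1 / (real n + 2)" by auto
  also have "\<dots> \<le> 1" by simp
  finally show "z \<in> \<bbbD>" by simp
qed

lemma set_integral_disc_exhaustion:
  fixes f :: "complex \<Rightarrow> 'b::{banach, second_countable_topology}"
  assumes "set_integrable lborel \<bbbD> f"
  shows "(\<lambda>n. LINT z:ball 0 (1 - 1 / (real n + 2))|lborel. f z) \<longlonglongrightarrow> (LINT z:\<bbbD>|lborel. f z)"
proof -
  have "(\<lambda>n. LINT z:ball 0 (1 - 1 / (real n + 2))|lborel. f z)
      \<longlonglongrightarrow> (LINT z:(\<Union>n. ball 0 (1 - 1 / (real n + 2)))|lborel. f z)"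
  proof (rule set_integral_cont_up)
    show "incseq (\<lambda>n. ball (0::complex) (1 - 1 / (real n + 2)))"
      by (intro incseq_SucI subset_ball) (simp add: field_simps)
    show "set_integrable lborel (\<Union>n. ball 0 (1 - 1 / (real n + 2))) f"
      using assms unfolding disc_eq_UN_balls .
  qed auto
  then show ?thesis
    unfolding disc_eq_UN_balls[symmetric] .
qed

lemma set_integrable_mult_cnj_power:
  assumes "q \<in> bergman_space"
  shows "set_integrable lborel \<bbbD> (\<lambda>z. q z * cnj z ^ k)"
proof -
  have "(\<lambda>z. z ^ k) \<in> bergman_space"
    by (rule bergman_space_bounded[where K = 1])
      (auto intro!: holomorphic_intros simp: norm_power power_le_one)
  from bergman_integrable[OF assms this] show ?thesis by simp
qed

lemma bergman_moment:
  assumes "q \<in> bergman_space"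
  shows "(LINT z:\<bbbD>|lborel. q z * cnj z ^ k) = of_real pi * ((deriv ^^ k) q 0 / (fact k * of_nat (Suc k)))"
proof -
  have "(\<lambda>n. (deriv ^^ k) q 0 / fact k * of_real (LINT z:ball 0 (1 - 1 / (real n + 2))|lborel. cmod z ^ (2 * k)))
      \<longlonglongrightarrow> (LINT z:\<bbbD>|lborel. q z * cnj z ^ k)"
  proof -
    have "(\<lambda>n. LINT z:ball 0 (1 - 1 / (real n + 2))|lborel. q z * cnj z ^ k) \<longlonglongrightarrow> (LINT z:\<bbbD>|lborel. q z * cnj z ^ k)"
      using assms by (intro set_integral_disc_exhaustion set_integrable_mult_cnj_power)
    moreover have "(LINT z:ball 0 (1 - 1 / (real n + 2))|lborel. q z * cnj z ^ k)
        = (deriv ^^ k) q 0 / fact k * of_real (LINT z:ball 0 (1 - 1 / (real n + 2))|lborel. cmod z ^ (2 * k))" for n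
      using assms by (intro holomorphic_moment_ball[where R = 1]) (auto dest: bergman_spaceD simp: field_simps)
    ultimately show ?thesis by (simp only:)
  qed
  moreover have "(\<lambda>n. (deriv ^^ k) q 0 / fact k * of_real (LINT z:ball 0 (1 - 1 / (real n + 2))|lborel. cmod z ^ (2 * k)))
      \<longlonglongrightarrow> (deriv ^^ k) q 0 / fact k * of_real (LINT z:\<bbbD>|lborel. cmod z ^ (2 * k))"
    by (intro tendsto_intros set_integral_disc_exhaustion set_integrable_ball_bounded[where K = 1])
      (auto intro!: continuous_intros power_le_one)
  ultimately have "(LINT z:\<bbbD>|lborel. q z * cnj z ^ k)
      = (deriv ^^ k) q 0 / fact k * of_real (LINT z:\<bbbD>|lborel. cmod z ^ (2 * k))"
    by (rule LIMSEQ_unique)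
  then show ?thesis
    unfolding integral_norm_power_unit_disc by (simp add: add.commute)
qed

text \<open>Expand the conjugated kernel in powers of \<open>b * cnj z\<close> and integrate
  termwise, dominated by \<open>cmod (q z)\<close>. The moments of \<open>q\<close> turn the result
  into the Taylor series of \<open>(deriv ^^ m) q\<close> at 0, evaluated at
  \<open>b\<close>.\<close>

lemma bergman_inner_kernel_deriv:
  assumes q: "q \<in> bergman_space" and b: "b \<in> \<bbbD>"
  shows "bergman_inner q (kernel_deriv m b) = (deriv ^^ m) q b"
proof -
  define C where "C j = (fact (j + Suc m) / fact j :: complex)" for j
  have hol: "q holomorphic_on \<bbbD>" using q by (rule bergman_spaceD)
  have int: "set_integrable lborel \<bbbD> (\<lambda>z. C j * b ^ j * (q z * cnj z ^ (j + m)))" for j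
    using q by (intro set_integrable_mult_right set_integrable_mult_cnj_power)
  have "(\<lambda>j. LINT z:\<bbbD>|lborel. C j * b ^ j * (q z * cnj z ^ (j + m)))
      sums (LINT z:\<bbbD>|lborel. q z * cnj (kernel_deriv m b z))"
  proof (rule sums_set_integral_dominated[OF int, where h = "\<lambda>z. cmod (q z)" and c = "\<lambda>j. cmod (C j * b ^ j)"])
    show "set_integrable lborel \<bbbD> (\<lambda>z. cmod (q z))"
      using set_integrable_norm[OF set_integrable_mult_cnj_power[OF q, of 0]] by simp
    show "norm (C j * b ^ j * (q z * cnj z ^ (j + m))) \<le> cmod (C j * b ^ j) * cmod (q z)" if "z \<in> \<bbbD>" for j z
    proof -
      have "cmod (q z) * cmod z ^ (j + m) \<le> cmod (q z) * 1"
        using that by (intro mult_left_mono power_le_one) auto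
      then have "cmod (C j * b ^ j) * (cmod (q z) * cmod z ^ (j + m)) \<le> cmod (C j * b ^ j) * cmod (q z)"
        by (intro mult_left_mono) auto
      then show ?thesis by (simp add: norm_mult norm_power)
    qed
    \<comment> \<open>The point \<open>(cmod b + 1) / 2\<close> lies strictly between
      \<open>cmod b\<close> and 1, so convergence there gives absolute convergence at
      \<open>b\<close>.\<close>
    have "summable (\<lambda>j. C j * of_real ((cmod b + 1) / 2) ^ j)"
      unfolding C_def using b negative_binomial_series[of "of_real ((cmod b + 1) / 2)" m]
      by (simp add: sums_iff del: of_real_divide of_real_add fact_Suc)
    then show "summable (\<lambda>j. cmod (C j * b ^ j))"
      by (rule powser_insidea) (use b in \<open>simp del: of_real_divide of_real_add\<close>)
    fix z :: complex assume z: "z \<in> \<bbbD>"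
    have "(\<lambda>j. C j * (b * cnj z) ^ j) sums (fact (Suc m) / (1 - b * cnj z) ^ (m + 2))"
      unfolding C_def using disc_mult_ne_1(1)[OF b z]
      by (intro negative_binomial_series) (simp add: norm_mult)
    then have "(\<lambda>j. q z * cnj z ^ m * (C j * (b * cnj z) ^ j)) sums (q z * cnj z ^ m * (fact (Suc m) / (1 - b * cnj z) ^ (m + 2)))"
      by (rule sums_mult)
    moreover have "q z * cnj z ^ m * (fact (Suc m) / (1 - b * cnj z) ^ (m + 2)) = q z * cnj (kernel_deriv m b z)"
      by (simp add: kernel_deriv_def del: fact_Suc)
    moreover have "q z * cnj z ^ m * (C j * (b * cnj z) ^ j) = C j * b ^ j * (q z * cnj z ^ (j + m))" for j
      by (simp add: power_mult_distrib power_add mult_ac)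
    ultimately show "(\<lambda>j. C j * b ^ j * (q z * cnj z ^ (j + m))) sums (q z * cnj (kernel_deriv m b z))"
      by simp
  qed
  moreover have "(LINT z:\<bbbD>|lborel. C j * b ^ j * (q z * cnj z ^ (j + m)))
      = of_real pi * ((deriv ^^ j) ((deriv ^^ m) q) 0 / fact j * (b - 0) ^ j)" for j
  proof -
    \<comment> \<open>The extra factor \<open>j + m + 1\<close> cancels the one in the denominator
      of \<open>bergman_moment\<close>.\<close>
    have "fact (j + Suc m) = (fact (j + m) * of_nat (Suc (j + m)) :: complex)"
      by (simp add: mult.commute)
    then show ?thesis
      unfolding set_integral_mult_right bergman_moment[OF q] C_def
      by (simp add: funpow_add mult_ac del: fact_Suc of_nat_Suc)
  qed
  ultimately have "(\<lambda>j. of_real pi * ((deriv ^^ j) ((deriv ^^ m) q) 0 / fact j * (b - 0) ^ j))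
      sums (LINT z:\<bbbD>|lborel. q z * cnj (kernel_deriv m b z))"
    by simp
  moreover have "(\<lambda>j. of_real pi * ((deriv ^^ j) ((deriv ^^ m) q) 0 / fact j * (b - 0) ^ j))
      sums (of_real pi * (deriv ^^ m) q b)"
    using hol b by (intro sums_mult holomorphic_power_series[where r = 1] holomorphic_higher_deriv) auto
  ultimately have "(LINT z:\<bbbD>|lborel. q z * cnj (kernel_deriv m b z)) = of_real pi * (deriv ^^ m) q b"
    by (rule sums_unique2)
  then show ?thesis
    by (simp add: bergman_inner_def)
qed

section \<open>Decay at the boundary\<close>

lemma set_integral_ball_translate:
  fixes f :: "complex \<Rightarrow> 'b::{banach, second_countable_topology}"
  assumes "continuous_on (ball b r) f"
  shows "(LINT z:ball 0 r|lborel. f (b + z)) = (LINT z:ball b r|lborel. f z)"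
proof -
  let ?F = "\<lambda>z. indicator (ball b r) z *\<^sub>R f z"
  have [measurable]: "?F \<in> borel_measurable borel"
    using assms by (intro borel_measurable_continuous_on_indicator) auto
  have "integral\<^sup>L lborel ?F = integral\<^sup>L (distr lborel borel ((+) b)) ?F"
    by (simp only: lborel_distr_plus)
  also have "\<dots> = integral\<^sup>L lborel (\<lambda>z. ?F (b + z))"
    by (rule integral_distr) simp_all
  also have "(\<lambda>z. ?F (b + z)) = (\<lambda>z. indicator (ball 0 r) z *\<^sub>R f (b + z))"
    by (auto simp: indicator_def dist_norm fun_eq_iff)
  finally show ?thesis
    by (simp add: set_lebesgue_integral_def)
qed

text \<open>The mean value property is applied to the holomorphic function \<open>q\<^sup>2\<close>, which saves Cauchy-Schwarz.\<close>

lemma bergman_mean_value_bound: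
  assumes q: "q \<in> bergman_space" and r: "0 < r" "cmod b + r < 1"
  shows "(cmod (q b))\<^sup>2 * (pi * r\<^sup>2) \<le> (LINT z:ball b r|lborel. (cmod (q z))\<^sup>2)"
proof -
  have sub: "ball b r \<subseteq> \<bbbD>"
  proof
    fix z assume "z \<in> ball b r"
    then show "z \<in> \<bbbD>"
      using r norm_triangle_sub[of z b] by (simp add: dist_norm norm_minus_commute)
  qed
  have cont: "continuous_on (ball b r) q"
    using bergman_spaceD(2)[OF q] sub by (rule continuous_on_subset)
  have hol: "(\<lambda>z. (q (b + z))\<^sup>2) holomorphic_on ball 0 (1 - cmod b)"
  proof -
    have "q \<circ> (\<lambda>z. b + z) holomorphic_on ball 0 (1 - cmod b)"
    proof (rule holomorphic_on_compose)
      show "(\<lambda>z. b + z) holomorphic_on ball 0 (1 - cmod b)" by (intro holomorphic_intros)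
      show "q holomorphic_on (\<lambda>z. b + z) ` ball 0 (1 - cmod b)"
        using bergman_spaceD(1)[OF q]
      proof (rule holomorphic_on_subset)
        show "(\<lambda>z. b + z) ` ball 0 (1 - cmod b) \<subseteq> \<bbbD>"
        proof (rule image_subsetI)
          fix z :: complex assume "z \<in> ball 0 (1 - cmod b)"
          then show "b + z \<in> \<bbbD>" using norm_triangle_ineq[of b z] by simp
        qed
      qed
    qed
    then show ?thesis unfolding comp_def by (rule holomorphic_on_power)
  qed
  have "(LINT z:ball 0 r|lborel. (q (b + z))\<^sup>2) = (q b)\<^sup>2 * of_real (pi * r\<^sup>2)"
    using holomorphic_moment_ball[OF hol r(1), of 0] r
    by (simp add: set_lebesgue_integral_def content_ball unit_ball_vol_2)
  moreover have "(LINT z:ball 0 r|lborel. (q (b + z))\<^sup>2) = (LINT z:ball b r|lborel. (q z)\<^sup>2)"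
    using cont by (intro set_integral_ball_translate[where f = "\<lambda>z. (q z)\<^sup>2"] continuous_intros)
  ultimately have "(cmod (q b))\<^sup>2 * (pi * r\<^sup>2) = cmod (LINT z:ball b r|lborel. (q z)\<^sup>2)"
    by (simp add: norm_mult norm_power)
  also have "\<dots> \<le> (LINT z:ball b r|lborel. cmod ((q z)\<^sup>2))"
  proof (rule set_integral_norm_bound)
    show "set_integrable lborel (ball b r) (\<lambda>z. (q z)\<^sup>2)"
    proof (rule set_integrable_bound)
      show "set_integrable lborel (ball b r) (\<lambda>z. (cmod (q z))\<^sup>2)"
        by (rule set_integrable_subset[OF bergman_spaceD(3)[OF q] _ sub]) simp
      show "set_borel_measurable lborel (ball b r) (\<lambda>z. (q z)\<^sup>2)"
        using borel_measurable_continuous_on_indicator[OF _ continuous_on_power[OF cont]]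
        by (simp add: set_borel_measurable_def)
    qed (simp add: norm_power)
  qed
  finally show ?thesis by (simp add: norm_power)
qed

text \<open>The ball around \<open>b\<close> whose radius is half the distance to the circle lies in
  a thin boundary annulus once \<open>b\<close> is close to the circle. There the integral of
  \<open>(cmod (q z))\<^sup>2\<close> is a small tail, and the mean value bound transfers this to
  \<open>q b\<close>.\<close>

lemma bergman_boundary_decay:
  assumes q: "q \<in> bergman_space" and e: "0 < e"
  obtains R where "R < 1" "\<And>b. \<lbrakk>b \<in> \<bbbD>; R < cmod b\<rbrakk> \<Longrightarrow> (1 - cmod b)\<^sup>2 * (cmod (q b))\<^sup>2 < e"
proof -
  let ?f = "\<lambda>z. (cmod (q z))\<^sup>2"
  let ?A = "\<lambda>n. ball (0::complex) (1 - 1 / (real n + 2))"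
  have int: "set_integrable lborel \<bbbD> ?f" using q by (rule bergman_spaceD)
  have "(\<lambda>n. LINT z:?A n|lborel. ?f z) \<longlonglongrightarrow> (LINT z:\<bbbD>|lborel. ?f z)"
    using int by (rule set_integral_disc_exhaustion)
  \<comment> \<open>The 4 compensates \<open>r\<^sup>2 = (1 - cmod b)\<^sup>2 / 4\<close>, and
    \<open>pi\<close> is the area constant of the mean value bound.\<close>
  then obtain n where n: "\<bar>(LINT z:?A n|lborel. ?f z) - (LINT z:\<bbbD>|lborel. ?f z)\<bar> < e / 4 * pi"
    using e LIMSEQ_D[of _ _ "e / 4 * pi"] by fastforce
  define s where "s = 1 - 1 / (real n + 2)"
  have s: "s < 1" by (simp add: s_def)
  show thesis
  \<comment> \<open>The condition \<open>(2 * s + 1) / 3 \<le> cmod b\<close> says that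
    \<open>cmod b - r \<ge> s\<close> for \<open>r = (1 - cmod b) / 2\<close>, which keeps the ball
    around \<open>b\<close> outside \<open>?A n\<close>.\<close>
  proof (rule that[of "max 0 ((2 * s + 1) / 3)"])
    show "max 0 ((2 * s + 1) / 3) < 1" using s by simp
    fix b assume b: "b \<in> \<bbbD>" and "max 0 ((2 * s + 1) / 3) < cmod b"
    then have bs: "s \<le> (3 * cmod b - 1) / 2" by simp
    define r where "r = (1 - cmod b) / 2"
    have r: "0 < r" "cmod b + r < 1" using b by (auto simp: r_def field_simps)
    have sub: "ball b r \<subseteq> \<bbbD> - ?A n"
    proof
      fix z assume "z \<in> ball b r"
      then have z: "cmod (b - z) < r" by (simp add: dist_norm)
      have "cmod z \<le> cmod b + cmod (b - z)"
        using norm_triangle_sub[of z b] by (simp add: norm_minus_commute)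
      moreover have "cmod b - cmod (b - z) \<le> cmod z"
        using norm_triangle_sub[of b z] by simp
      ultimately show "z \<in> \<bbbD> - ?A n"
        using z r bs unfolding s_def[symmetric] by (auto simp: r_def)
    qed
    have subA: "?A n \<subseteq> \<bbbD>"
      using s unfolding s_def[symmetric] by (intro subset_ball) simp
    have "(cmod (q b))\<^sup>2 * (pi * r\<^sup>2) \<le> (LINT z:ball b r|lborel. ?f z)"
      using q r by (rule bergman_mean_value_bound)
    also have "\<dots> \<le> (LINT z:\<bbbD> - ?A n|lborel. ?f z)"
      using set_integrable_subset[OF int, of "\<bbbD> - ?A n"] set_integrable_subset[OF int, of "ball b r"] sub
      unfolding set_lebesgue_integral_def set_integrable_def
      by (intro integral_mono) (auto split: split_indicator)
    also have "(LINT z:\<bbbD> - ?A n|lborel. ?f z) = (LINT z:\<bbbD>|lborel. ?f z) - (LINT z:?A n|lborel. ?f z)"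
    proof -
      have "(LINT z:(\<bbbD> - ?A n) \<union> ?A n|lborel. ?f z) = (LINT z:\<bbbD> - ?A n|lborel. ?f z) + (LINT z:?A n|lborel. ?f z)"
        using int subA by (intro set_integral_Un) (auto intro: set_integrable_subset)
      moreover have "(\<bbbD> - ?A n) \<union> ?A n = \<bbbD>" using subA by blast
      ultimately show ?thesis by simp
    qed
    also have "\<dots> < e / 4 * pi" using n by linarith
    finally have "pi * ((1 - cmod b)\<^sup>2 * (cmod (q b))\<^sup>2) < pi * e"
      by (simp add: r_def power_divide mult_ac)
    then show "(1 - cmod b)\<^sup>2 * (cmod (q b))\<^sup>2 < e"
      by simp
  qed
qed

section \<open>The last Gram-Schmidt coefficient\<close>

text \<open>The closed form of \<open>gen_kernel\<close> and the factorizations by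
  \<open>root_poly\<close> hold inside the disc only, so the Bergman notions must be transferred
  between functions agreeing there.\<close>

lemma bergman_space_cong:
  assumes "\<And>z. z \<in> \<bbbD> \<Longrightarrow> f z = g z"
  shows "f \<in> bergman_space \<longleftrightarrow> g \<in> bergman_space"
proof -
  have "f holomorphic_on \<bbbD> \<longleftrightarrow> g holomorphic_on \<bbbD>"
    using assms by (intro holomorphic_cong) auto
  moreover have "set_integrable lborel \<bbbD> (\<lambda>z. (cmod (f z))\<^sup>2) \<longleftrightarrow> set_integrable lborel \<bbbD> (\<lambda>z. (cmod (g z))\<^sup>2)"
    using assms by (intro set_integrable_cong) auto
  ultimately show ?thesis by (simp add: bergman_space_def)
qed

lemma bergman_inner_cong:
  assumes "\<And>z. z \<in> \<bbbD> \<Longrightarrow> f z = f' z" "\<And>z. z \<in> \<bbbD> \<Longrightarrow> g z = g' z"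
  shows "bergman_inner f g = bergman_inner f' g'"
proof -
  have "(LINT z:\<bbbD>|lborel. f z * cnj (g z)) = (LINT z:\<bbbD>|lborel. f' z * cnj (g' z))"
    using assms by (intro set_lebesgue_integral_cong) auto
  then show ?thesis by (simp add: bergman_inner_def)
qed

lemma bergman_norm_cong:
  assumes "\<And>z. z \<in> \<bbbD> \<Longrightarrow> f z = g z"
  shows "bergman_norm f = bergman_norm g"
proof -
  have "(LINT z:\<bbbD>|lborel. (cmod (f z))\<^sup>2) = (LINT z:\<bbbD>|lborel. (cmod (g z))\<^sup>2)"
    using assms by (intro set_lebesgue_integral_cong) auto
  then show ?thesis by (simp add: bergman_norm_def)
qed

lemma bergman_norm_mult_bounded_le:
  assumes "f \<in> bergman_space" "h holomorphic_on \<bbbD>" "\<And>z. z \<in> \<bbbD> \<Longrightarrow> cmod (h z) \<le> K"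
  shows "(bergman_norm (\<lambda>z. h z * f z))\<^sup>2 \<le> K\<^sup>2 * (bergman_norm f)\<^sup>2"
proof -
  have "(LINT z:\<bbbD>|lborel. (cmod (h z * f z))\<^sup>2) \<le> (LINT z:\<bbbD>|lborel. K\<^sup>2 * (cmod (f z))\<^sup>2)"
  proof (rule set_integral_mono)
    show "set_integrable lborel \<bbbD> (\<lambda>z. (cmod (h z * f z))\<^sup>2)"
      using bergman_space_mult_bounded[OF assms] by (rule bergman_spaceD(3))
    show "set_integrable lborel \<bbbD> (\<lambda>z. K\<^sup>2 * (cmod (f z))\<^sup>2)"
      using assms(1) by (intro set_integrable_mult_right) (auto dest: bergman_spaceD)
    show "(cmod (h z * f z))\<^sup>2 \<le> K\<^sup>2 * (cmod (f z))\<^sup>2" if "z \<in> \<bbbD>" for z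
      using assms(3)[OF that] by (auto simp: norm_mult power_mult_distrib intro!: mult_right_mono power_mono)
  qed
  also have "\<dots> = K\<^sup>2 * (LINT z:\<bbbD>|lborel. (cmod (f z))\<^sup>2)"
    by (rule set_integral_mult_right)
  finally have "(LINT z:\<bbbD>|lborel. (cmod (h z * f z))\<^sup>2) / pi \<le> K\<^sup>2 * (LINT z:\<bbbD>|lborel. (cmod (f z))\<^sup>2) / pi"
    by (rule divide_right_mono) simp
  then show ?thesis by (simp add: bergman_norm_power2)
qed

text \<open>The denominator stays away from 0 because
  \<open>cmod (1 - cnj w * z) \<ge> 1 - cmod w\<close>, so the function is bounded for fixed
  \<open>w\<close>.\<close>

lemma kernel_deriv_in_space:
  assumes "w \<in> \<bbbD>" shows "kernel_deriv m w \<in> bergman_space"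
proof (rule bergman_space_bounded)
  show "kernel_deriv m w holomorphic_on \<bbbD>"
    unfolding kernel_deriv_def[abs_def]
    using disc_mult_ne_1(2)[OF assms] by (intro holomorphic_intros) auto
  fix z assume z: "z \<in> \<bbbD>"
  have "1 - cmod w \<le> cmod (1 - cnj w * z)"
  proof -
    have "cmod (cnj w * z) \<le> cmod w * 1"
      using z unfolding norm_mult complex_mod_cnj by (intro mult_left_mono) auto
    then show ?thesis using norm_triangle_ineq2[of 1 "cnj w * z"] by simp
  qed
  then have "(1 - cmod w) ^ (m + 2) \<le> cmod (1 - cnj w * z) ^ (m + 2)"
    using assms by (intro power_mono) auto
  moreover have "0 < (1 - cmod w) ^ (m + 2)"
    using assms by (intro zero_less_power) simp
  moreover have "fact (Suc m) * cmod z ^ m \<le> fact (Suc m) * 1"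
    using z by (intro mult_left_mono power_le_one) auto
  ultimately show "cmod (kernel_deriv m w z) \<le> fact (Suc m) * 1 / (1 - cmod w) ^ (m + 2)"
    unfolding kernel_deriv_def norm_divide norm_mult norm_power norm_fact
    by (intro frac_le) auto
qed

section \<open>Gram-Schmidt vectors of the generalized kernels\<close>

lemma gen_kernel_in_space:
  assumes "as ! j \<in> \<bbbD>" shows "gen_kernel as j \<in> bergman_space"
  using kernel_deriv_in_space[OF assms] gen_kernel_eq[OF assms] bergman_space_cong by metis

lemma bergman_inner_gen_kernel:
  assumes "q \<in> bergman_space" "as ! j \<in> \<bbbD>"
  shows "bergman_inner q (gen_kernel as j) = (deriv ^^ (occurrence as j - 1)) q (as ! j)"
proof -
  have "bergman_inner q (gen_kernel as j) = bergman_inner q (kernel_deriv (occurrence as j - 1) (as ! j))"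
    using gen_kernel_eq[OF assms(2)] by (intro bergman_inner_cong) auto
  then show ?thesis
    using bergman_inner_kernel_deriv[OF assms] by simp
qed

text \<open>The value of \<open>occurrence\<close> depends on earlier entries only, so appending
  \<open>b\<close> leaves the previous kernels, and hence their orthonormalization,
  unchanged.\<close>

lemma gen_kernels_snoc: "gen_kernels (as @ [b]) = gen_kernels as @ [gen_kernel (as @ [b]) (length as)]"
  by (auto simp: gen_kernels_def gen_kernel_def fun_eq_iff occurrence_append nth_append)

lemma gen_kernels_subset:
  assumes "set as \<subseteq> \<bbbD>" shows "set (gen_kernels as) \<subseteq> bergman_space"
  using assms by (auto simp: gen_kernels_def intro!: gen_kernel_in_space)

abbreviation (input) kernel_basis :: "complex list \<Rightarrow> (complex \<Rightarrow> complex) list" where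
  "kernel_basis as \<equiv> gram_schmidt_orthonormalization (gen_kernels as)"

text \<open>The vector \<open>u_b\<close> of the overview.\<close>

definition kernel_residual :: "complex list \<Rightarrow> complex \<Rightarrow> complex \<Rightarrow> complex" where
  "kernel_residual as b = bergman_residual (kernel_basis as) (gen_kernel (as @ [b]) (length as))"

lemma kernel_basis_snoc_nth:
  "kernel_basis (as @ [b]) ! length as = bergman_normalize (kernel_residual as b)"
proof -
  have "length (kernel_basis as) = length as"
    by (simp add: length_gram_schmidt gen_kernels_def)
  then show ?thesis
    by (simp add: gen_kernels_snoc gram_schmidt_snoc kernel_residual_def nth_append)
qed

lemma orthogonal_kernel_basis_iff:
  assumes "set as \<subseteq> \<bbbD>" "q \<in> bergman_space"
  shows "(\<forall>B\<in>set (kernel_basis as). bergman_inner q B = 0)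
    \<longleftrightarrow> (\<forall>i<length as. (deriv ^^ (occurrence as i - 1)) q (as ! i) = 0)"
proof -
  have "(\<forall>B\<in>set (kernel_basis as). bergman_inner q B = 0)
      \<longleftrightarrow> (\<forall>v\<in>set (gen_kernels as). bergman_inner q v = 0)"
    using assms by (intro gram_schmidt_orthogonal_iff gen_kernels_subset)
  also have "\<dots> \<longleftrightarrow> (\<forall>i<length as. bergman_inner q (gen_kernel as i) = 0)"
    by (auto simp: gen_kernels_def)
  also have "\<dots> \<longleftrightarrow> (\<forall>i<length as. (deriv ^^ (occurrence as i - 1)) q (as ! i) = 0)"
    using assms by (auto simp: bergman_inner_gen_kernel subset_iff)
  finally show ?thesis .
qed

lemma kernel_residual_in_space:
  assumes "set as \<subseteq> \<bbbD>" "b \<in> \<bbbD>"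
  shows "kernel_residual as b \<in> bergman_space"
  unfolding kernel_residual_def using assms
  by (intro bergman_residual_in_space set_gram_schmidt_subset gen_kernels_subset gen_kernel_in_space) auto

text \<open>Divisibility by \<open>root_poly as\<close> makes \<open>q\<close> orthogonal to the
  earlier vectors, so the projection part of the residual contributes nothing. What remains is the
  reproducing property for a derivative whose order is the multiplicity of \<open>b\<close> in
  \<open>as\<close>.\<close>

lemma bergman_inner_kernel_residual:
  assumes as: "set as \<subseteq> \<bbbD>" and b: "b \<in> \<bbbD>" and q: "q \<in> bergman_space"
    and k: "k holomorphic_on \<bbbD>" "\<And>z. z \<in> \<bbbD> \<Longrightarrow> q z = root_poly as z * k z"
  shows "bergman_inner q (kernel_residual as b) = root_factor as b * k b"
proof -
  have hol: "(\<lambda>z. root_poly as z * k z) holomorphic_on \<bbbD>"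
    using k(1) by (intro holomorphic_intros)
  have deriv_eq: "(deriv ^^ i) q z = (deriv ^^ i) (\<lambda>z. root_poly as z * k z) z" if "z \<in> \<bbbD>" for i z
    using bergman_spaceD(1)[OF q] hol that k(2)
    by (intro higher_deriv_transform_within_open) auto
  have "\<forall>i<length as. (deriv ^^ (occurrence as i - 1)) q (as ! i) = 0"
  proof (intro allI impI)
    fix i assume i: "i < length as"
    then have ai: "as ! i \<in> \<bbbD>" using as nth_mem by blast
    show "(deriv ^^ (occurrence as i - 1)) q (as ! i) = 0"
      unfolding deriv_eq[OF ai] using k(1) ai i by (intro higher_deriv_root_poly_mult_eq_0) auto
  qed
  then have "\<forall>B\<in>set (kernel_basis as). bergman_inner q B = 0"
    using orthogonal_kernel_basis_iff[OF as q] by blast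
  then have "bergman_inner q (kernel_residual as b) = bergman_inner q (gen_kernel (as @ [b]) (length as))"
    unfolding kernel_residual_def using as b q
    by (intro bergman_inner_residual_right set_gram_schmidt_subset gen_kernels_subset gen_kernel_in_space) auto
  also have "\<dots> = (deriv ^^ count_list as b) q b"
    using bergman_inner_gen_kernel[OF q, of "as @ [b]" "length as"] b occurrence_snoc[of as b] by simp
  also have "\<dots> = root_factor as b * k b"
    unfolding deriv_eq[OF b] using k(1) b by (intro higher_deriv_root_poly_mult) auto
  finally show ?thesis .
qed

text \<open>Orthogonality to the basis means vanishing derivatives at the prescribed points, hence
  divisibility. Applied to \<open>f\<close> this yields \<open>h\<close>; applied to the last kernel
  it yields the extremal \<open>k\<close>.\<close>

lemma residual_factorization:
  assumes as: "set as \<subseteq> \<bbbD>" and v: "v \<in> bergman_space"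
  obtains k where "k holomorphic_on \<bbbD>"
    "\<And>z. z \<in> \<bbbD> \<Longrightarrow> bergman_residual (kernel_basis as) v z = root_poly as z * k z"
proof -
  let ?q = "bergman_residual (kernel_basis as) v"
  have q: "?q \<in> bergman_space"
    using as v by (intro bergman_residual_in_space set_gram_schmidt_subset gen_kernels_subset)
  have "\<forall>B\<in>set (kernel_basis as). bergman_inner ?q B = 0"
    using as v by (intro ballI bergman_inner_residual_gram_schmidt gen_kernels_subset)
  then have "\<forall>i<length as. (deriv ^^ (occurrence as i - 1)) ?q (as ! i) = 0"
    using orthogonal_kernel_basis_iff[OF as q] by blast
  with that show thesis
    using root_poly_factorization[OF open_ball bergman_spaceD(1)[OF q] as] by blast
qed

section \<open>The extremal description of the coefficient\<close>

definition coefficient_sq :: "(complex \<Rightarrow> complex) \<Rightarrow> complex list \<Rightarrow> complex \<Rightarrow> real" where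
  "coefficient_sq f as b = (cmod (bergman_inner f (bergman_normalize (kernel_residual as b))))\<^sup>2"

text \<open>The minimum description of \<open>F\<close> from the overview, written without division
  so that the inequality also covers \<open>k b = 0\<close>. A single \<open>h\<close> serves all
  \<open>b\<close>.\<close>

lemma coefficient_ratio:
  assumes f: "f \<in> bergman_space" and as: "set as \<subseteq> \<bbbD>"
  obtains h where "h holomorphic_on \<bbbD>" "(\<lambda>z. root_poly as z * h z) \<in> bergman_space"
    "\<And>b k. \<lbrakk>b \<in> \<bbbD>; k holomorphic_on \<bbbD>; (\<lambda>z. root_poly as z * k z) \<in> bergman_space\<rbrakk>
        \<Longrightarrow> (cmod (k b))\<^sup>2 * coefficient_sq f as b \<le> (cmod (h b))\<^sup>2 * (bergman_norm (\<lambda>z. root_poly as z * k z))\<^sup>2"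
    "\<And>b. b \<in> \<bbbD> \<Longrightarrow> \<exists>k. k holomorphic_on \<bbbD> \<and> (\<lambda>z. root_poly as z * k z) \<in> bergman_space \<and> k b \<noteq> 0 \<and>
        (cmod (k b))\<^sup>2 * coefficient_sq f as b = (cmod (h b))\<^sup>2 * (bergman_norm (\<lambda>z. root_poly as z * k z))\<^sup>2"
proof -
  let ?g = "bergman_residual (kernel_basis as) f"
  let ?u = "kernel_residual as"
  obtain h where h: "h holomorphic_on \<bbbD>" "\<And>z. z \<in> \<bbbD> \<Longrightarrow> ?g z = root_poly as z * h z"
    using residual_factorization[OF as f] by blast
  have basis: "set (kernel_basis as) \<subseteq> bergman_space"
    using as by (intro set_gram_schmidt_subset gen_kernels_subset)
  have g: "?g \<in> bergman_space"
    using basis f by (rule bergman_residual_in_space)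
  have hP: "(\<lambda>z. root_poly as z * h z) \<in> bergman_space"
    using g bergman_space_cong[OF h(2)] by simp
  have u: "?u b \<in> bergman_space" if "b \<in> \<bbbD>" for b
    using as that by (rule kernel_residual_in_space)
  have inner_u: "bergman_inner (\<lambda>z. root_poly as z * k z) (?u b) = root_factor as b * k b"
    if "b \<in> \<bbbD>" "k holomorphic_on \<bbbD>" "(\<lambda>z. root_poly as z * k z) \<in> bergman_space" for b k
    using as that by (intro bergman_inner_kernel_residual) auto
  have CS: "cmod (root_factor as b) * cmod (k b) \<le> bergman_norm (\<lambda>z. root_poly as z * k z) * bergman_norm (?u b)"
    if "b \<in> \<bbbD>" "k holomorphic_on \<bbbD>" "(\<lambda>z. root_poly as z * k z) \<in> bergman_space" for b k
    using bergman_Cauchy_Schwarz[OF that(3) u[OF that(1)]] inner_u[OF that] by (simp add: norm_mult)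
  \<comment> \<open>Test Cauchy-Schwarz with \<open>k = 1\<close>: \<open>root_poly as\<close> is
    bounded on the disc, and its pairing with \<open>?u b\<close> is
    \<open>root_factor as b\<close>, which is not 0.\<close>
  have u_nz: "bergman_norm (?u b) \<noteq> 0" if b: "b \<in> \<bbbD>" for b
  proof -
    have "(\<lambda>z. root_poly as z * 1) \<in> bergman_space"
      using root_poly_bound[OF as] by (intro bergman_space_bounded) (auto intro!: holomorphic_intros)
    then show ?thesis
      using CS[OF b, of "\<lambda>_. 1"] root_factor_nonzero[of as b] by auto
  qed
  have F: "coefficient_sq f as b = (cmod (root_factor as b))\<^sup>2 * (cmod (h b))\<^sup>2 / (bergman_norm (?u b))\<^sup>2" if b: "b \<in> \<bbbD>" for b
  proof -
    have "bergman_inner (?u b) B = 0" if "B \<in> set (kernel_basis as)" for B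
      unfolding kernel_residual_def using as b that
      by (intro bergman_inner_residual_gram_schmidt gen_kernels_subset gen_kernel_in_space) auto
    \<comment> \<open>Since \<open>?u b\<close> is orthogonal to the basis, \<open>f\<close> may be
      replaced by its residual, to which the factorization by \<open>h\<close> applies.\<close>
    then have "bergman_inner (?u b) ?g = bergman_inner (?u b) f"
      using basis f u[OF b] by (intro bergman_inner_residual_right)
    then have "bergman_inner f (?u b) = bergman_inner ?g (?u b)"
      by (metis bergman_inner_commute)
    also have "\<dots> = root_factor as b * h b"
      using as b g h by (rule bergman_inner_kernel_residual)
    finally show ?thesis
      by (simp add: coefficient_sq_def bergman_inner_normalize_right norm_divide norm_mult power_divide power_mult_distrib)
  qed
  have le: "(cmod (k b))\<^sup>2 * coefficient_sq f as b \<le> (cmod (h b))\<^sup>2 * (bergman_norm (\<lambda>z. root_poly as z * k z))\<^sup>2"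
    if b: "b \<in> \<bbbD>" and k: "k holomorphic_on \<bbbD>" "(\<lambda>z. root_poly as z * k z) \<in> bergman_space" for b k
  proof -
    have "(cmod (root_factor as b) * cmod (k b))\<^sup>2 \<le> (bergman_norm (\<lambda>z. root_poly as z * k z) * bergman_norm (?u b))\<^sup>2"
      using CS[OF b k] by (intro power_mono) auto
    then have "(cmod (root_factor as b))\<^sup>2 * (cmod (k b))\<^sup>2 / (bergman_norm (?u b))\<^sup>2 \<le> (bergman_norm (\<lambda>z. root_poly as z * k z))\<^sup>2"
      using u_nz[OF b] by (simp add: power_mult_distrib divide_le_eq)
    then have "(cmod (h b))\<^sup>2 * ((cmod (root_factor as b))\<^sup>2 * (cmod (k b))\<^sup>2 / (bergman_norm (?u b))\<^sup>2)
        \<le> (cmod (h b))\<^sup>2 * (bergman_norm (\<lambda>z. root_poly as z * k z))\<^sup>2"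
      by (rule mult_left_mono) simp
    then show ?thesis by (simp add: F[OF b] mult_ac)
  qed
  have eq: "\<exists>k. k holomorphic_on \<bbbD> \<and> (\<lambda>z. root_poly as z * k z) \<in> bergman_space \<and> k b \<noteq> 0 \<and>
      (cmod (k b))\<^sup>2 * coefficient_sq f as b = (cmod (h b))\<^sup>2 * (bergman_norm (\<lambda>z. root_poly as z * k z))\<^sup>2" if b: "b \<in> \<bbbD>" for b
  proof -
    have gk: "gen_kernel (as @ [b]) (length as) \<in> bergman_space"
      using b by (intro gen_kernel_in_space) simp
    obtain k where k: "k holomorphic_on \<bbbD>" "\<And>z. z \<in> \<bbbD> \<Longrightarrow> ?u b z = root_poly as z * k z"
      using residual_factorization[OF as gk] unfolding kernel_residual_def by blast
    have kP: "(\<lambda>z. root_poly as z * k z) \<in> bergman_space"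
      using u[OF b] bergman_space_cong[OF k(2)] by simp
    have norm_eq: "bergman_norm (\<lambda>z. root_poly as z * k z) = bergman_norm (?u b)"
      by (rule bergman_norm_cong) (simp add: k(2))
    \<comment> \<open>As \<open>?u b\<close> is itself of the form \<open>root_poly as * k\<close>,
      pairing it with itself gives equality in Cauchy-Schwarz and also
      \<open>k b \<noteq> 0\<close>.\<close>
    have "of_real ((bergman_norm (?u b))\<^sup>2) = root_factor as b * k b"
      using bergman_inner_kernel_residual[OF as b u[OF b] k] by (simp add: bergman_inner_self)
    then have c: "(bergman_norm (?u b))\<^sup>2 = cmod (root_factor as b) * cmod (k b)"
      by (metis norm_mult norm_of_real abs_of_nonneg zero_le_power2)
    then have "k b \<noteq> 0" using u_nz[OF b] by auto
    moreover have "(cmod (k b))\<^sup>2 * coefficient_sq f as b = (cmod (h b))\<^sup>2 * (bergman_norm (?u b))\<^sup>2"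
    proof -
      have "(cmod (k b))\<^sup>2 * coefficient_sq f as b = (cmod (h b))\<^sup>2 * (cmod (root_factor as b) * cmod (k b))\<^sup>2 / (bergman_norm (?u b))\<^sup>2"
        by (simp add: F[OF b] power_mult_distrib mult_ac)
      also have "\<dots> = (cmod (h b))\<^sup>2 * (bergman_norm (?u b))\<^sup>2"
        unfolding c[symmetric] using u_nz[OF b] by (simp add: power2_eq_square)
      finally show ?thesis .
    qed
    ultimately show ?thesis using k(1) kP norm_eq by auto
  qed
  show thesis
    using that[OF h(1) hP le eq] .
qed

section \<open>Existence of a maximum\<close>

text \<open>If no maximum exists, each \<open>x\<close> has a neighbourhood on which
  \<open>F\<close> stays below \<open>F (Y x)\<close> for some \<open>Y x\<close> in
  \<open>K\<close>. In a finite subcover, the point \<open>Y x\<close> with the largest value lies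
  in some \<open>U z\<close> and is beaten by \<open>Y z\<close>, a contradiction.\<close>

lemma upper_semicontinuous_attains_max:
  fixes F :: "'a::topological_space \<Rightarrow> 'b::linorder"
  assumes "compact K" "K \<noteq> {}"
    and usc: "\<And>x c. \<lbrakk>x \<in> K; F x < c\<rbrakk> \<Longrightarrow> \<exists>U. open U \<and> x \<in> U \<and> (\<forall>y\<in>U \<inter> K. F y < c)"
  obtains x where "x \<in> K" "\<And>y. y \<in> K \<Longrightarrow> F y \<le> F x"
proof -
  have "\<exists>x\<in>K. \<forall>y\<in>K. F y \<le> F x"
  proof (rule ccontr)
    assume no: "\<not> (\<exists>x\<in>K. \<forall>y\<in>K. F y \<le> F x)"
    have "\<exists>y U. y \<in> K \<and> open U \<and> x \<in> U \<and> (\<forall>z\<in>U \<inter> K. F z < F y)" if x: "x \<in> K" for x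
    proof -
      obtain y where "y \<in> K" "F x < F y" using no x by (meson not_le)
      then show ?thesis using usc[OF x \<open>F x < F y\<close>] by blast
    qed
    then obtain Y U where YU: "\<And>x. x \<in> K \<Longrightarrow> Y x \<in> K \<and> open (U x) \<and> x \<in> U x \<and> (\<forall>z\<in>U x \<inter> K. F z < F (Y x))"
      by metis
    obtain X where X: "X \<subseteq> K" "finite X" "K \<subseteq> (\<Union>x\<in>X. U x)"
      using compactE_image[OF assms(1), of K U] YU by blast
    have "X \<noteq> {}" using X(3) assms(2) by auto
    then have "Max ((\<lambda>z. F (Y z)) ` X) \<in> (\<lambda>z. F (Y z)) ` X"
      using X(2) by (intro Max_in) auto
    then obtain x where x: "x \<in> X" "F (Y x) = Max ((\<lambda>z. F (Y z)) ` X)"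
      by auto
    have le: "F (Y z) \<le> F (Y x)" if "z \<in> X" for z
      unfolding x(2) using X(2) that by (intro Max_ge) auto
    have "Y x \<in> K" using YU x(1) X(1) by blast
    then obtain z where z: "z \<in> X" "Y x \<in> U z" using X(3) by blast
    then have "F (Y x) < F (Y z)" using YU X(1) \<open>Y x \<in> K\<close> by blast
    with le[OF z(1)] show False by simp
  qed
  with that show thesis by blast
qed

lemma root_poly_lower_bound:
  assumes "\<And>a. a \<in> set as \<Longrightarrow> cmod a + d \<le> cmod z" "0 \<le> d"
  shows "d ^ length as \<le> cmod (root_poly as z)"
  using assms(1)
proof (induction as)
  case (Cons a as)
  have "d \<le> cmod (z - a)"
    using Cons.prems[of a] norm_triangle_ineq2[of z a] by simp
  with Cons assms(2) show ?case
    by (auto simp: root_poly_def norm_mult intro!: mult_mono)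
qed (simp add: root_poly_def)

text \<open>For \<open>m = 0\<close> the function is the Bergman kernel at \<open>b\<close>, whose
  squared norm is its value at \<open>b\<close> by the reproducing property. Each root factor is at
  most 2 on the disc, which costs 4 after squaring.\<close>

lemma bergman_norm_root_poly_kernel:
  assumes as: "set as \<subseteq> \<bbbD>" and b: "b \<in> \<bbbD>"
  shows "(\<lambda>z. root_poly as z * kernel_deriv 0 b z) \<in> bergman_space"
    and "(bergman_norm (\<lambda>z. root_poly as z * kernel_deriv 0 b z))\<^sup>2 \<le> 4 ^ length as * cmod (kernel_deriv 0 b b)"
proof -
  have "root_poly as holomorphic_on \<bbbD>"
    by (rule root_poly_holomorphic)
  note P = kernel_deriv_in_space[OF b, of 0] this root_poly_bound[OF as]
  show "(\<lambda>z. root_poly as z * kernel_deriv 0 b z) \<in> bergman_space"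
    using P by (rule bergman_space_mult_bounded)
  have "of_real ((bergman_norm (kernel_deriv 0 b))\<^sup>2) = kernel_deriv 0 b b"
    using bergman_inner_kernel_deriv[OF P(1) b, of 0] by (simp add: bergman_inner_self)
  then have "(bergman_norm (kernel_deriv 0 b))\<^sup>2 = cmod (kernel_deriv 0 b b)"
    by (metis norm_of_real abs_of_nonneg zero_le_power2)
  moreover have "(bergman_norm (\<lambda>z. root_poly as z * kernel_deriv 0 b z))\<^sup>2 \<le> (2 ^ length as)\<^sup>2 * (bergman_norm (kernel_deriv 0 b))\<^sup>2"
    using P by (rule bergman_norm_mult_bounded_le)
  moreover have "(2 ^ length as)\<^sup>2 = (4 ^ length as :: real)"
    by (simp add: power2_eq_square flip: power_mult_distrib)
  ultimately show "(bergman_norm (\<lambda>z. root_poly as z * kernel_deriv 0 b z))\<^sup>2 \<le> 4 ^ length as * cmod (kernel_deriv 0 b b)"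
    by simp
qed

lemma kernel_deriv_0_diag: "cmod (kernel_deriv 0 b b) = 1 / (1 - (cmod b)\<^sup>2)\<^sup>2"
proof -
  have "1 - cnj b * b = of_real (1 - (cmod b)\<^sup>2)"
    by (simp only: of_real_diff of_real_1 complex_norm_square mult.commute)
  then have "cmod (1 - cnj b * b) = \<bar>1 - (cmod b)\<^sup>2\<bar>"
    by (simp only: norm_of_real)
  then have "cmod ((1 - cnj b * b)\<^sup>2) = (1 - (cmod b)\<^sup>2)\<^sup>2"
    by (simp only: norm_power power2_abs)
  then show ?thesis
    by (simp add: kernel_deriv_def norm_divide power2_eq_square[symmetric])
qed

text \<open>If \<open>F x > 0\<close> somewhere, boundary decay with \<open>e = F x\<close> confines
  the competition to a compact disc containing \<open>x\<close>. Otherwise \<open>F\<close> vanishes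
  on the disc and 0 will do.\<close>

lemma attains_max_of_semicontinuous_boundary:
  fixes F :: "complex \<Rightarrow> real"
  assumes nonneg: "\<And>b. b \<in> \<bbbD> \<Longrightarrow> 0 \<le> F b"
    and usc: "\<And>x c. \<lbrakk>x \<in> \<bbbD>; F x < c\<rbrakk> \<Longrightarrow> \<exists>U. open U \<and> x \<in> U \<and> (\<forall>y\<in>U \<inter> \<bbbD>. F y < c)"
    and boundary: "\<And>e. 0 < e \<Longrightarrow> \<exists>R<1. \<forall>b\<in>\<bbbD>. R < cmod b \<longrightarrow> F b < e"
  obtains a where "a \<in> \<bbbD>" "\<And>b. b \<in> \<bbbD> \<Longrightarrow> F b \<le> F a"
proof (cases "\<exists>x\<in>\<bbbD>. 0 < F x")
  case False
  then have "F b \<le> F 0" if "b \<in> \<bbbD>" for b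
  proof -
    have "F b \<le> 0" using False that by (meson not_le)
    also have "0 \<le> F 0" using nonneg by simp
    finally show ?thesis .
  qed
  then show thesis using that[of 0] by simp
next
  case True
  then obtain x where x: "x \<in> \<bbbD>" "0 < F x" by blast
  from boundary[OF x(2)] obtain R where R: "R < 1" "\<And>b. \<lbrakk>b \<in> \<bbbD>; R < cmod b\<rbrakk> \<Longrightarrow> F b < F x"
    by blast
  have xR: "cmod x \<le> R"
    using R(2)[OF x(1)] by (meson less_irrefl not_le)
  have sub: "cball 0 R \<subseteq> \<bbbD>" using R(1) by auto
  obtain a where a: "a \<in> cball 0 R" "\<And>y. y \<in> cball 0 R \<Longrightarrow> F y \<le> F a"
  proof (rule upper_semicontinuous_attains_max)
    show "compact (cball (0::complex) R)" by simp
    show "cball (0::complex) R \<noteq> {}" using order_trans[OF norm_ge_zero xR] by simp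
    fix y c assume "y \<in> cball 0 R" "F y < c"
    then show "\<exists>U. open U \<and> y \<in> U \<and> (\<forall>z\<in>U \<inter> cball 0 R. F z < c)"
      using usc[of y c] sub by blast
  qed blast
  have "F b \<le> F a" if "b \<in> \<bbbD>" for b
  proof (cases "cmod b \<le> R")
    case True
    then show ?thesis using a(2) by simp
  next
    case False
    then have "F b < F x" using R(2) that by simp
    also have "F x \<le> F a" using a(2) xR by simp
    finally show ?thesis by simp
  qed
  then show thesis using that a(1) sub by blast
qed

lemma coefficient_attains_max:
  assumes f: "f \<in> bergman_space" and as: "set as \<subseteq> \<bbbD>"
  obtains a where "a \<in> \<bbbD>" "\<And>b. b \<in> \<bbbD> \<Longrightarrow> coefficient_sq f as b \<le> coefficient_sq f as a"
proof -
  let ?F = "coefficient_sq f as"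
  let ?N = "\<lambda>k. (bergman_norm (\<lambda>z. root_poly as z * k z))\<^sup>2"
  show thesis
  proof (rule coefficient_ratio[OF f as])
    fix h assume h: "h holomorphic_on \<bbbD>" "(\<lambda>z. root_poly as z * h z) \<in> bergman_space"
      and le: "\<And>b k. \<lbrakk>b \<in> \<bbbD>; k holomorphic_on \<bbbD>; (\<lambda>z. root_poly as z * k z) \<in> bergman_space\<rbrakk>
          \<Longrightarrow> (cmod (k b))\<^sup>2 * ?F b \<le> (cmod (h b))\<^sup>2 * ?N k"
      and eq: "\<And>b. b \<in> \<bbbD> \<Longrightarrow> \<exists>k. k holomorphic_on \<bbbD> \<and> (\<lambda>z. root_poly as z * k z) \<in> bergman_space \<and> k b \<noteq> 0 \<and>
          (cmod (k b))\<^sup>2 * ?F b = (cmod (h b))\<^sup>2 * ?N k"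
    show thesis
    proof (rule attains_max_of_semicontinuous_boundary[of ?F])
      show "0 \<le> ?F b" for b by (simp add: coefficient_sq_def)
    next
      fix x c assume x: "x \<in> \<bbbD>" and c: "?F x < c"
      obtain k where k: "k holomorphic_on \<bbbD>" "(\<lambda>z. root_poly as z * k z) \<in> bergman_space" "k x \<noteq> 0"
        and eqx: "(cmod (k x))\<^sup>2 * ?F x = (cmod (h x))\<^sup>2 * ?N k"
        using eq[OF x] by blast
      \<comment> \<open>With \<open>k\<close> extremal at \<open>x\<close> kept fixed, this is the
        upper bound for \<open>?F y\<close> being below \<open>c\<close>, with the denominator
        \<open>(cmod (k y))\<^sup>2\<close> cleared.\<close>
      define U where "U = {y \<in> \<bbbD>. (cmod (h y))\<^sup>2 * ?N k - c * (cmod (k y))\<^sup>2 < 0}"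
      have "open U"
      proof -
        have "continuous_on \<bbbD> (\<lambda>y. (cmod (h y))\<^sup>2 * ?N k - c * (cmod (k y))\<^sup>2)"
          using h(1) k(1) by (intro continuous_intros holomorphic_on_imp_continuous_on)
        then have "open (\<bbbD> \<inter> (\<lambda>y. (cmod (h y))\<^sup>2 * ?N k - c * (cmod (k y))\<^sup>2) -` {..<0})"
          by (rule continuous_open_preimage) auto
        moreover have "\<bbbD> \<inter> (\<lambda>y. (cmod (h y))\<^sup>2 * ?N k - c * (cmod (k y))\<^sup>2) -` {..<0} = U"
          by (auto simp: U_def)
        ultimately show ?thesis by simp
      qed
      moreover have "x \<in> U"
      proof -
        have "(cmod (k x))\<^sup>2 * ?F x < (cmod (k x))\<^sup>2 * c"
          using k(3) c by (intro mult_strict_left_mono) auto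
        then show ?thesis
          using x unfolding eqx U_def mult.commute[of c] by simp
      qed
      moreover have "?F y < c" if "y \<in> U \<inter> \<bbbD>" for y
      proof -
        have "(cmod (k y))\<^sup>2 * ?F y < (cmod (k y))\<^sup>2 * c"
          using le[of y k] k(1,2) that unfolding U_def mult.commute[of c] by fastforce
        \<comment> \<open>Strictness rules out \<open>k y = 0\<close>, so the factor can be
          cancelled.\<close>
        then show ?thesis
          by (simp add: mult_less_cancel_left_disj)
      qed
      ultimately show "\<exists>U. open U \<and> x \<in> U \<and> (\<forall>y\<in>U \<inter> \<bbbD>. ?F y < c)" by blast
    next
      fix e :: real assume e: "0 < e"
      \<comment> \<open>All roots lie in the closed disc of radius \<open>r\<close>; inserting 0
        covers the empty list.\<close>
      obtain r where r: "r < 1" "0 \<le> r" "\<And>a. a \<in> set as \<Longrightarrow> cmod a \<le> r"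
      proof (rule that[of "Max (insert 0 (cmod ` set as))"])
        show "Max (insert 0 (cmod ` set as)) < 1"
          using as by (subst Max_less_iff) (auto simp: subset_iff)
      qed (auto intro: Max_ge)
      \<comment> \<open>Once \<open>cmod b\<close> exceeds \<open>(1 + r) / 2\<close>, every root is
        at distance at least \<open>(1 - r) / 2\<close>, so \<open>d\<close> bounds
        \<open>root_poly as\<close> from below at \<open>b\<close>.\<close>
      define d where "d = ((1 - r) / 2) ^ length as"
      have d: "0 < d" using r(1) by (simp add: d_def)
      \<comment> \<open>The first 4 comes from squaring \<open>t \<le> 2 * (1 - cmod b)\<close>, the
        power of 4 from the norm bound, and \<open>d\<^sup>2\<close> from passing from
        \<open>h\<close> to \<open>root_poly as * h\<close>.\<close>
      define C where "C = 4 * 4 ^ length as / d\<^sup>2"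
      have C: "0 < C" using d by (simp add: C_def)
      obtain R where R: "R < 1" "\<And>b. \<lbrakk>b \<in> \<bbbD>; R < cmod b\<rbrakk> \<Longrightarrow> (1 - cmod b)\<^sup>2 * (cmod (root_poly as b * h b))\<^sup>2 < e / C"
        using bergman_boundary_decay[OF h(2), of "e / C"] e C by (auto simp: zero_less_divide_iff)
      have "?F b < e" if b: "b \<in> \<bbbD>" and bR: "max R ((1 + r) / 2) < cmod b" for b
      proof -
        let ?k = "kernel_deriv 0 b"
        define t where "t = 1 - (cmod b)\<^sup>2"
        have t: "0 < t" using b by (simp add: t_def power_less_one_iff abs_square_less_1)
        have t2: "t \<le> 2 * (1 - cmod b)"
        proof -
          have "t = (1 + cmod b) * (1 - cmod b)"
            by (simp add: t_def power2_eq_square algebra_simps)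
          also have "\<dots> \<le> 2 * (1 - cmod b)"
            using b by (intro mult_right_mono) auto
          finally show ?thesis .
        qed
        have kd: "cmod (?k b) = 1 / t\<^sup>2"
          by (simp add: kernel_deriv_0_diag t_def)
        have "(cmod (?k b))\<^sup>2 * ?F b \<le> (cmod (h b))\<^sup>2 * ?N ?k"
          using b kernel_deriv_in_space[OF b] bergman_norm_root_poly_kernel(1)[OF as b]
          by (intro le) (auto dest: bergman_spaceD)
        also have "\<dots> \<le> (cmod (h b))\<^sup>2 * (4 ^ length as * cmod (?k b))"
          using bergman_norm_root_poly_kernel(2)[OF as b] by (rule mult_left_mono) simp
        \<comment> \<open>The kernel value \<open>1 / t\<^sup>2\<close> enters squared on the left
          and once on the right, which leaves \<open>t\<^sup>2\<close>.\<close>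
        finally have "?F b \<le> (cmod (h b))\<^sup>2 * 4 ^ length as * t\<^sup>2"
          using t by (simp add: kd field_simps power2_eq_square)
        also have "\<dots> \<le> (cmod (h b))\<^sup>2 * 4 ^ length as * (2 * (1 - cmod b))\<^sup>2"
          using t t2 by (intro mult_left_mono power_mono) auto
        also have "\<dots> = C * ((1 - cmod b)\<^sup>2 * (d * cmod (h b))\<^sup>2)"
          using d unfolding C_def power_mult_distrib by simp
        also have "\<dots> \<le> C * ((1 - cmod b)\<^sup>2 * (cmod (root_poly as b * h b))\<^sup>2)"
        proof -
          have "d \<le> cmod (root_poly as b)"
            unfolding d_def
          proof (rule root_poly_lower_bound)
            fix a assume "a \<in> set as"
            with r(3)[of a] bR show "cmod a + (1 - r) / 2 \<le> cmod b" by (simp add: field_simps)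
          qed (use r(1) in simp)
          then show ?thesis
            using C d unfolding norm_mult by (intro mult_left_mono power_mono mult_right_mono) auto
        qed
        also have "\<dots> < C * (e / C)"
          using R(2)[OF b] bR C by (intro mult_strict_left_mono) auto
        finally show ?thesis using C by simp
      qed
      then show "\<exists>R<1. \<forall>b\<in>\<bbbD>. R < cmod b \<longrightarrow> ?F b < e"
        using R(1) r(1) by (intro exI[of _ "max R ((1 + r) / 2)"]) auto
    qed (use that in blast)
  qed
qed

theorem theorem4p2:
  fixes f :: "complex \<Rightarrow> complex" and n :: nat and as :: "complex list"
    and B :: "complex \<Rightarrow> complex \<Rightarrow> complex"
  assumes "f \<in> bergman_space"
    and "n \<ge> 1" and "length as = n - 1" and "set as \<subseteq> \<bbbD>"
  defines "B \<equiv> (\<lambda>b. gram_schmidt_orthonormalization (gen_kernels (as @ [b])) ! (n - 1))"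
  shows "\<exists>a\<^sub>n\<in>\<bbbD>. ereal ((cmod (bergman_inner f (B a\<^sub>n)))\<^sup>2) =
           (SUP b\<in>\<bbbD>. ereal ((cmod (bergman_inner f (B b)))\<^sup>2))"
proof -
  have B: "B b = bergman_normalize (kernel_residual as b)" for b
    unfolding B_def assms(3)[symmetric] by (rule kernel_basis_snoc_nth)
  obtain a where a: "a \<in> \<bbbD>"
    "\<And>b. b \<in> \<bbbD> \<Longrightarrow> (cmod (bergman_inner f (B b)))\<^sup>2 \<le> (cmod (bergman_inner f (B a)))\<^sup>2"
    using coefficient_attains_max[OF assms(1,4)] unfolding B coefficient_sq_def by blast
  have "ereal ((cmod (bergman_inner f (B a)))\<^sup>2) = (SUP b\<in>\<bbbD>. ereal ((cmod (bergman_inner f (B b)))\<^sup>2))"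
    by (rule antisym) (use a in \<open>auto intro!: SUP_upper SUP_least\<close>)
  then show ?thesis using a(1) by blast
qed

end
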